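(* Let $b<\infty$, let $0\neq g\in\mathbf{SOC}(-\infty,b)$ be non-constant, and let $A,B$ be self-adjoint operators on a complex Hilbert space with spectra in $(-\infty,b)$. If $A>B$, then $$g(A)-g(B)\geq g(\tau_{A})-g\left(\tau_{A}-\|(A-B)^{-1}\|^{-1}\right)\geq g\left(\tau_{B}+\|(A-B)^{-1}\|^{-1}\right)-g(\tau_{B})>0,$$ where $\tau_{A}=\min\mathrm{sp}(A)$ and $\tau_{B}=\min\mathrm{sp}(B)$.
   Context: Operators are bounded linear operators on a complex Hilbert space $\mathcal{H}$ (nonzero, otherwise arbitrary), and $\|\cdot\|$ is the operator norm. $\mathrm{sp}(A)$ is the spectrum of $A$. $A\ge 0$ (positive) means $\langle Ax,x\rangle\ge 0$ for all $x\in\mathcal{H}$; $A>0$ means $A$ is positive and invertible; for self-adjoint $A,B$, $A\ge B$ means $A-B\ge 0$ and $A>B$ means $A-B>0$; a scalar in an operator inequality stands for that multiple of $I$. $g(A)$ denotes the continuous functional calculus. A continuous real-valued function $g$ on an interval $J$ is strongly operator convex on $J$, written $g\in\mathbf{SOC}(J)$, if $P g(PAP)P\le g(A)$ for every self-adjoint operator $A$ (on any complex Hilbert space) with spectrum in $J$ and every orthogonal projection $P$; here $g(PAP)$ is computed for the compression of $A$ to the range of $P$, so $Pg(PAP)P$ equals $g(PAP|_{P\mathcal{H}})$ on $P\mathcal{H}$ and $0$ on $(P\mathcal{H})^\perp$. *)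

theory Defs
  imports "HOL-Analysis.Analysis"
begin

section \<open>Complex Hilbert spaces\<close>

text \<open>
  A complex Hilbert space is a complete real inner product space together with a compatible complex
  scalar multiplication and a complex inner product whose real part is the real inner product.
  The norm is thus the Hilbert space norm, and the topological and metric notions of the library
  (in particular \<^const>\<open>bounded_linear\<close> and \<^const>\<open>onorm\<close>) apply.
  The complex inner product is linear in its first argument.
\<close>

class complex_hilbert_space = real_inner + complete_space +
  fixes scaleC :: "complex \<Rightarrow> 'a \<Rightarrow> 'a"  (infixr \<open>*\<^sub>C\<close> 75)
    and cinner :: "'a \<Rightarrow> 'a \<Rightarrow> complex"
  assumes scaleC_add_right: "a *\<^sub>C (x + y) = a *\<^sub>C x + a *\<^sub>C y"
    and scaleC_add_left: "(a + b) *\<^sub>C x = a *\<^sub>C x + b *\<^sub>C x"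
    and scaleC_scaleC: "a *\<^sub>C b *\<^sub>C x = (a * b) *\<^sub>C x"
    and scaleC_of_real: "complex_of_real r *\<^sub>C x = r *\<^sub>R x"
    and cinner_commute: "cinner x y = cnj (cinner y x)"
    and cinner_add_left: "cinner (x + y) z = cinner x z + cinner y z"
    and cinner_scaleC_left: "cinner (a *\<^sub>C x) y = a * cinner x y"
    and Re_cinner: "Re (cinner x y) = inner x y"
begin

lemma cinner_scaleC_right: "cinner x (a *\<^sub>C y) = cnj a * cinner x y"
  by (metis cinner_commute cinner_scaleC_left complex_cnj_mult)

lemma cinner_self: "cinner x x = complex_of_real ((norm x)\<^sup>2)"
proof (rule complex_eqI)
  show "Re (cinner x x) = Re (complex_of_real ((norm x)\<^sup>2))"
    by (simp add: Re_cinner power2_norm_eq_inner)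
  have "Im (cinner x x) = - Im (cinner x x)"
    using cinner_commute[of x x] by (metis cnj.simps(2))
  then show "Im (cinner x x) = Im (complex_of_real ((norm x)\<^sup>2))"
    by simp
qed

lemma norm_scaleC: "norm (a *\<^sub>C x) = cmod a * norm x"
proof -
  have "cinner (a *\<^sub>C x) (a *\<^sub>C x) = (a * cnj a) * cinner x x"
    by (simp add: cinner_scaleC_left cinner_scaleC_right)
  then have "complex_of_real ((norm (a *\<^sub>C x))\<^sup>2) = complex_of_real ((cmod a * norm x)\<^sup>2)"
    by (simp add: cinner_self power_mult_distrib complex_norm_square[symmetric])
  then have "(norm (a *\<^sub>C x))\<^sup>2 = (cmod a * norm x)\<^sup>2"
    using of_real_eq_iff by blast
  then show ?thesis
    by simp
qed

lemma Im_cinner: "Im (cinner x y) = inner ((- \<i>) *\<^sub>C x) y"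
  by (simp add: Re_cinner[symmetric] cinner_scaleC_left)

end

instantiation complex :: complex_hilbert_space
begin

definition "scaleC_complex a (x :: complex) = a * x"
definition "cinner_complex x (y :: complex) = x * cnj y"

instance
  by standard
    (auto simp: scaleC_complex_def cinner_complex_def algebra_simps scaleR_conv_of_real inner_complex_def)

end


section \<open>The Hilbert space of square-summable sequences in a Hilbert space\<close>

typedef (overloaded) 'a ell2 =
  "{f :: nat \<Rightarrow> 'a::complex_hilbert_space. summable (\<lambda>n. (norm (f n))\<^sup>2)}"
  by (rule exI[of _ "\<lambda>_. 0"]) simp

setup_lifting type_definition_ell2

lemma norm_add_square_le:
  fixes x y :: "'a::real_inner"
  shows "(norm (x + y))\<^sup>2 \<le> 2 * (norm x)\<^sup>2 + 2 * (norm y)\<^sup>2"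
proof -
  have "(norm (x + y))\<^sup>2 + (norm (x - y))\<^sup>2 = 2 * (norm x)\<^sup>2 + 2 * (norm y)\<^sup>2"
    by (simp add: power2_norm_eq_inner inner_add_left inner_add_right inner_diff_left inner_diff_right)
  then show ?thesis
    by (metis le_add_same_cancel1 zero_le_power2)
qed

lemma summable_norm_square_add:
  fixes f g :: "nat \<Rightarrow> 'a::real_inner"
  assumes "summable (\<lambda>n. (norm (f n))\<^sup>2)" "summable (\<lambda>n. (norm (g n))\<^sup>2)"
  shows "summable (\<lambda>n. (norm (f n + g n))\<^sup>2)"
  by (rule summable_comparison_test'[OF
        summable_add[OF summable_mult[OF assms(1), of 2] summable_mult[OF assms(2), of 2]], of 0])
    (use norm_add_square_le in auto)

lemma summable_inner:
  fixes f g :: "nat \<Rightarrow> 'a::real_inner"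
  assumes "summable (\<lambda>n. (norm (f n))\<^sup>2)" "summable (\<lambda>n. (norm (g n))\<^sup>2)"
  shows "summable (\<lambda>n. inner (f n) (g n))"
proof (rule summable_comparison_test'[OF summable_add[OF assms], of 0])
  fix n
  have "\<bar>inner (f n) (g n)\<bar> \<le> norm (f n) * norm (g n)"
    by (rule Cauchy_Schwarz_ineq2)
  also have "\<dots> \<le> 2 * norm (f n) * norm (g n)"
    by simp
  also have "\<dots> \<le> (norm (f n))\<^sup>2 + (norm (g n))\<^sup>2"
    by (rule sum_squares_bound)
  finally show "norm (inner (f n) (g n)) \<le> (norm (f n))\<^sup>2 + (norm (g n))\<^sup>2"
    by simp
qed

lemma summable_cinner:
  fixes f g :: "nat \<Rightarrow> 'a::complex_hilbert_space"
  assumes "summable (\<lambda>n. (norm (f n))\<^sup>2)" "summable (\<lambda>n. (norm (g n))\<^sup>2)"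
  shows "summable (\<lambda>n. cinner (f n) (g n))"
  unfolding summable_complex_iff Re_cinner Im_cinner
  using assms by (auto intro!: summable_inner simp: norm_scaleC)

instantiation ell2 :: (complex_hilbert_space) real_vector
begin

lift_definition zero_ell2 :: "'a ell2" is "\<lambda>_. 0"
  by simp

lift_definition plus_ell2 :: "'a ell2 \<Rightarrow> 'a ell2 \<Rightarrow> 'a ell2" is "\<lambda>f g n. f n + g n"
  by (rule summable_norm_square_add)

lift_definition uminus_ell2 :: "'a ell2 \<Rightarrow> 'a ell2" is "\<lambda>f n. - f n"
  by simp

lift_definition minus_ell2 :: "'a ell2 \<Rightarrow> 'a ell2 \<Rightarrow> 'a ell2" is "\<lambda>f g n. f n - g n"
proof -
  fix f g :: "nat \<Rightarrow> 'a"
  assume "summable (\<lambda>n. (norm (f n))\<^sup>2)" "summable (\<lambda>n. (norm (g n))\<^sup>2)"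
  then show "summable (\<lambda>n. (norm (f n - g n))\<^sup>2)"
    using summable_norm_square_add[of f "\<lambda>n. - g n"] by simp
qed

lift_definition scaleR_ell2 :: "real \<Rightarrow> 'a ell2 \<Rightarrow> 'a ell2" is "\<lambda>r f n. r *\<^sub>R f n"
  by (simp add: power_mult_distrib summable_mult)

instance
proof
  fix x y z :: "'a ell2" and a b :: real
  show "x + y + z = x + (y + z)" "0 + x = x" "- x + x = 0" "x - y = x + - y"
    by (transfer; simp add: add.assoc)+
  show "x + y = y + x"
    by transfer (simp add: add.commute)
  show "a *\<^sub>R (x + y) = a *\<^sub>R x + a *\<^sub>R y" "(a + b) *\<^sub>R x = a *\<^sub>R x + b *\<^sub>R x"
    "a *\<^sub>R b *\<^sub>R x = (a * b) *\<^sub>R x" "1 *\<^sub>R x = x"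
    by (transfer; simp add: scaleR_add_right scaleR_add_left)+
qed

end

instantiation ell2 :: (complex_hilbert_space) real_inner
begin

lift_definition inner_ell2 :: "'a ell2 \<Rightarrow> 'a ell2 \<Rightarrow> real" is "\<lambda>f g. \<Sum>n. inner (f n) (g n)" .

definition norm_ell2 :: "'a ell2 \<Rightarrow> real" where
  "norm_ell2 f = sqrt (inner f f)"

definition dist_ell2 :: "'a ell2 \<Rightarrow> 'a ell2 \<Rightarrow> real" where
  "dist_ell2 f g = norm (f - g)"

definition sgn_ell2 :: "'a ell2 \<Rightarrow> 'a ell2" where
  "sgn_ell2 f = f /\<^sub>R norm f"

definition uniformity_ell2 :: "('a ell2 \<times> 'a ell2) filter" where
  "uniformity_ell2 = (INF e\<in>{0<..}. principal {(x, y). dist x y < e})"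

definition open_ell2 :: "'a ell2 set \<Rightarrow> bool" where
  "open_ell2 U \<longleftrightarrow> (\<forall>x\<in>U. \<forall>\<^sub>F (x', y) in uniformity. x' = x \<longrightarrow> y \<in> U)"

instance
proof
  fix x y z :: "'a ell2" and a b :: real and U :: "'a ell2 set"
  show "sgn x = x /\<^sub>R norm x" "dist x y = norm (x - y)"
    "uniformity = (INF e\<in>{0<..}. principal {(x, y :: 'a ell2). dist x y < e})"
    "open U = (\<forall>x\<in>U. \<forall>\<^sub>F (x', y) in uniformity. x' = x \<longrightarrow> y \<in> U)"
    "norm x = sqrt (inner x x)"
    by (simp_all add: sgn_ell2_def dist_ell2_def uniformity_ell2_def open_ell2_def norm_ell2_def)
  show "inner x y = inner y x"
    by transfer (simp add: inner_commute)
  show "inner (x + y) z = inner x z + inner y z"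
    by transfer (simp add: inner_add_left suminf_add summable_inner)
  show "inner (a *\<^sub>R x) y = a * inner x y"
    by transfer (simp add: suminf_mult summable_inner)
  show "0 \<le> inner x x"
    by transfer (simp add: suminf_nonneg summable_inner)
  show "inner x x = 0 \<longleftrightarrow> x = 0"
  proof (transfer, goal_cases)
    case (1 x)
    have "(\<Sum>n. inner (x n) (x n)) = 0 \<longleftrightarrow> (\<forall>n. inner (x n) (x n) = 0)"
      using 1 by (intro suminf_eq_zero_iff summable_inner) auto
    then show ?case
      by (auto simp: fun_eq_iff)
  qed
qed

end

lemma norm_ell2_square: "(norm x)\<^sup>2 = (\<Sum>n. (norm (Rep_ell2 x n))\<^sup>2)"
  by (simp add: power2_norm_eq_inner inner_ell2.rep_eq)

lemma summable_Rep_ell2: "summable (\<lambda>n. (norm (Rep_ell2 x n))\<^sup>2)"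
  using Rep_ell2[of x] by simp

lemma sum_Rep_ell2_le: "(\<Sum>n<N. (norm (Rep_ell2 x n))\<^sup>2) \<le> (norm x)\<^sup>2"
  unfolding norm_ell2_square by (rule sum_le_suminf[OF summable_Rep_ell2]) auto

lemma norm_Rep_ell2_le: "norm (Rep_ell2 x n) \<le> norm x"
proof -
  have "(norm (Rep_ell2 x n))\<^sup>2 \<le> (\<Sum>k<Suc n. (norm (Rep_ell2 x k))\<^sup>2)"
    by (simp add: sum_nonneg)
  also have "\<dots> \<le> (norm x)\<^sup>2"
    by (rule sum_Rep_ell2_le)
  finally show ?thesis
    by (rule power2_le_imp_le) simp
qed

instance ell2 :: (complex_hilbert_space) complete_space
proof
  fix X :: "nat \<Rightarrow> 'a ell2"
  assume X: "Cauchy X"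
  have "Cauchy (\<lambda>k. Rep_ell2 (X k) n)" for n
  proof (rule metric_CauchyI)
    fix e :: real assume "e > 0"
    then obtain M where M: "\<And>j k. j \<ge> M \<Longrightarrow> k \<ge> M \<Longrightarrow> dist (X j) (X k) < e"
      using metric_CauchyD[OF X] by metis
    have "dist (Rep_ell2 (X j) n) (Rep_ell2 (X k) n) \<le> dist (X j) (X k)" for j k
      using norm_Rep_ell2_le[of "X j - X k" n] by (simp add: dist_norm minus_ell2.rep_eq)
    then show "\<exists>M. \<forall>j\<ge>M. \<forall>k\<ge>M. dist (Rep_ell2 (X j) n) (Rep_ell2 (X k) n) < e"
      using M by (meson le_less_trans)
  qed
  then have "\<forall>n. \<exists>l. (\<lambda>k. Rep_ell2 (X k) n) \<longlonglongrightarrow> l"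
    by (simp add: Cauchy_convergent_iff convergent_def)
  then obtain L where L: "\<And>n. (\<lambda>k. Rep_ell2 (X k) n) \<longlonglongrightarrow> L n"
    by metis
  have tail: "\<exists>M. \<forall>j\<ge>M. \<forall>N. (\<Sum>n<N. (norm (Rep_ell2 (X j) n - L n))\<^sup>2) \<le> e\<^sup>2" if "e > 0" for e :: real
  proof -
    obtain M where M: "\<And>j k. j \<ge> M \<Longrightarrow> k \<ge> M \<Longrightarrow> dist (X j) (X k) < e"
      using metric_CauchyD[OF X \<open>e > 0\<close>] by metis
    have "(\<Sum>n<N. (norm (Rep_ell2 (X j) n - L n))\<^sup>2) \<le> e\<^sup>2" if "j \<ge> M" for j N
    proof (rule tendsto_upperbound)
      show "(\<lambda>k. \<Sum>n<N. (norm (Rep_ell2 (X j) n - Rep_ell2 (X k) n))\<^sup>2)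
          \<longlonglongrightarrow> (\<Sum>n<N. (norm (Rep_ell2 (X j) n - L n))\<^sup>2)"
        by (intro tendsto_intros L)
      have "(\<Sum>n<N. (norm (Rep_ell2 (X j) n - Rep_ell2 (X k) n))\<^sup>2) \<le> e\<^sup>2" if "k \<ge> M" for k
      proof -
        have "(\<Sum>n<N. (norm (Rep_ell2 (X j) n - Rep_ell2 (X k) n))\<^sup>2) \<le> (norm (X j - X k))\<^sup>2"
          using sum_Rep_ell2_le[where x = "X j - X k"] by (simp add: minus_ell2.rep_eq)
        also have "\<dots> \<le> e\<^sup>2"
          using M[OF \<open>j \<ge> M\<close> \<open>k \<ge> M\<close>] by (intro power_mono) (auto simp: dist_norm)
        finally show ?thesis .
      qed
      then show "\<forall>\<^sub>F k in sequentially. (\<Sum>n<N. (norm (Rep_ell2 (X j) n - Rep_ell2 (X k) n))\<^sup>2) \<le> e\<^sup>2"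
        unfolding eventually_sequentially by blast
    qed simp
    then show ?thesis
      by blast
  qed
  have summ: "summable (\<lambda>n. (norm (Rep_ell2 (X j) n - L n))\<^sup>2)"
    if "\<forall>N. (\<Sum>n<N. (norm (Rep_ell2 (X j) n - L n))\<^sup>2) \<le> e" for j e
    using that by (intro bounded_imp_summable[of _ e])
      (auto simp: lessThan_Suc_atMost[symmetric] simp del: sum.lessThan_Suc)
  obtain j where j: "\<forall>N. (\<Sum>n<N. (norm (Rep_ell2 (X j) n - L n))\<^sup>2) \<le> 1\<^sup>2"
    using tail[of 1] by (metis order_refl zero_less_one)
  have "summable (\<lambda>n. (norm (Rep_ell2 (X j) n + (L n - Rep_ell2 (X j) n)))\<^sup>2)"
    using summ[OF j] by (intro summable_norm_square_add summable_Rep_ell2) (simp add: norm_minus_commute)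
  then have "summable (\<lambda>n. (norm (L n))\<^sup>2)"
    by simp
  then have Rep: "Rep_ell2 (Abs_ell2 L) = L"
    by (simp add: Abs_ell2_inverse)
  have "X \<longlonglongrightarrow> Abs_ell2 L"
  proof (rule metric_LIMSEQ_I)
    fix e :: real assume "e > 0"
    then obtain M where M: "\<And>j N. j \<ge> M \<Longrightarrow> (\<Sum>n<N. (norm (Rep_ell2 (X j) n - L n))\<^sup>2) \<le> (e / 2)\<^sup>2"
      using tail[of "e / 2"] by auto
    have "dist (X j) (Abs_ell2 L) < e" if "j \<ge> M" for j
    proof -
      have "(norm (X j - Abs_ell2 L))\<^sup>2 \<le> (e / 2)\<^sup>2"
        unfolding norm_ell2_square minus_ell2.rep_eq Rep
        by (rule suminf_le_const) (use M[OF that] summ in blast)+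
      then have "norm (X j - Abs_ell2 L) \<le> e / 2"
        by (rule power2_le_imp_le) (use \<open>e > 0\<close> in simp)
      then show ?thesis
        using \<open>e > 0\<close> by (simp add: dist_norm)
    qed
    then show "\<exists>M. \<forall>j\<ge>M. dist (X j) (Abs_ell2 L) < e"
      by blast
  qed
  then show "convergent X"
    by (auto simp: convergent_def)
qed

instantiation ell2 :: (complex_hilbert_space) complex_hilbert_space
begin

lift_definition scaleC_ell2 :: "complex \<Rightarrow> 'a ell2 \<Rightarrow> 'a ell2" is "\<lambda>a f n. a *\<^sub>C f n"
  by (simp add: norm_scaleC power_mult_distrib summable_mult)

lift_definition cinner_ell2 :: "'a ell2 \<Rightarrow> 'a ell2 \<Rightarrow> complex" is "\<lambda>f g. \<Sum>n. cinner (f n) (g n)" .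

instance
proof
  fix x y z :: "'a ell2" and a b :: complex and r :: real
  show "a *\<^sub>C (x + y) = a *\<^sub>C x + a *\<^sub>C y" "(a + b) *\<^sub>C x = a *\<^sub>C x + b *\<^sub>C x"
    "a *\<^sub>C b *\<^sub>C x = (a * b) *\<^sub>C x" "complex_of_real r *\<^sub>C x = r *\<^sub>R x"
    by (transfer; simp add: scaleC_add_right scaleC_add_left scaleC_scaleC scaleC_of_real)+
  show "cinner (x + y) z = cinner x z + cinner y z"
    by transfer (simp add: cinner_add_left suminf_add summable_cinner)
  show "cinner (a *\<^sub>C x) y = a * cinner x y"
    by transfer (simp add: cinner_scaleC_left suminf_mult summable_cinner)
  show "Re (cinner x y) = inner x y"
    by transfer (simp add: Re_suminf summable_cinner Re_cinner)
  show "cinner x y = cnj (cinner y x)"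
  proof (transfer, goal_cases)
    case (1 x y)
    have "(\<lambda>n. cnj (cinner (y n) (x n))) sums cnj (\<Sum>n. cinner (y n) (x n))"
      using 1 unfolding sums_cnj by (intro summable_sums summable_cinner) auto
    then show ?case
      by (simp add: cinner_commute[of "x _" "y _", symmetric] sums_iff)
  qed
qed

end


section \<open>Operators\<close>

text \<open>
  Functional calculus is needed not only on the whole space but also on the range of a projection.
  A Hilbert space is therefore given by an orthogonal projection \<open>E\<close> on a type of class
  \<^class>\<open>complex_hilbert_space\<close>: it is the closed subspace \<open>range E\<close>, and \<open>E = id\<close> is the whole type.
  A bounded operator on \<open>range E\<close> is represented by its extension by \<open>0\<close> to the orthogonal complement
  of \<open>range E\<close>; these extensions are exactly the bounded operators \<open>A\<close> with \<open>E A = A = A E\<close>, and the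
  identity operator on \<open>range E\<close> is represented by \<open>E\<close>. The extension preserves norms, adjoints and
  positivity. It does not preserve spectra, so those are taken relative to \<open>E\<close>.
\<close>

definition bounded_operator :: "('a::complex_hilbert_space \<Rightarrow> 'a) \<Rightarrow> bool" where
  "bounded_operator A \<longleftrightarrow> bounded_linear A \<and> (\<forall>c x. A (c *\<^sub>C x) = c *\<^sub>C A x)"

definition self_adjoint :: "('a::complex_hilbert_space \<Rightarrow> 'a) \<Rightarrow> bool" where
  "self_adjoint A \<longleftrightarrow> bounded_operator A \<and> (\<forall>x y. cinner (A x) y = cinner x (A y))"

definition orthogonal_projection :: "('a::complex_hilbert_space \<Rightarrow> 'a) \<Rightarrow> bool" where
  "orthogonal_projection P \<longleftrightarrow> self_adjoint P \<and> P \<circ> P = P"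

definition positive_operator :: "('a::complex_hilbert_space \<Rightarrow> 'a) \<Rightarrow> bool" where
  "positive_operator A \<longleftrightarrow> bounded_operator A \<and> (\<forall>x. cinner (A x) x \<in> \<real>\<^sub>\<ge>\<^sub>0)"

definition operator_on :: "('a::complex_hilbert_space \<Rightarrow> 'a) \<Rightarrow> ('a \<Rightarrow> 'a) \<Rightarrow> bool" where
  "operator_on E A \<longleftrightarrow> bounded_operator A \<and> E \<circ> A = A \<and> A \<circ> E = A"

definition invertible_on :: "('a::complex_hilbert_space \<Rightarrow> 'a) \<Rightarrow> ('a \<Rightarrow> 'a) \<Rightarrow> bool" where
  "invertible_on E A \<longleftrightarrow> (\<exists>T. operator_on E T \<and> A \<circ> T = E \<and> T \<circ> A = E)"

definition spectrum_on :: "('a::complex_hilbert_space \<Rightarrow> 'a) \<Rightarrow> ('a \<Rightarrow> 'a) \<Rightarrow> complex set" where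
  "spectrum_on E A = {z. \<not> invertible_on E (\<lambda>x. z *\<^sub>C E x - A x)}"

abbreviation spectrum :: "('a::complex_hilbert_space \<Rightarrow> 'a) \<Rightarrow> complex set" where
  "spectrum \<equiv> spectrum_on id"

definition min_spectrum :: "('a::complex_hilbert_space \<Rightarrow> 'a) \<Rightarrow> real" where
  "min_spectrum A = (LEAST t. complex_of_real t \<in> spectrum A)"

definition operator_le :: "('a::complex_hilbert_space \<Rightarrow> 'a) \<Rightarrow> ('a \<Rightarrow> 'a) \<Rightarrow> bool"  (infix \<open>\<le>\<^sub>o\<^sub>p\<close> 50) where
  "A \<le>\<^sub>o\<^sub>p B \<longleftrightarrow> positive_operator (\<lambda>x. B x - A x)"

definition operator_less :: "('a::complex_hilbert_space \<Rightarrow> 'a) \<Rightarrow> ('a \<Rightarrow> 'a) \<Rightarrow> bool"  (infix \<open><\<^sub>o\<^sub>p\<close> 50) where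
  "A <\<^sub>o\<^sub>p B \<longleftrightarrow> positive_operator (\<lambda>x. B x - A x) \<and> invertible_on id (\<lambda>x. B x - A x)"


section \<open>Continuous functional calculus\<close>

text \<open>\<open>E\<close> takes the place of the identity operator in the constant term.\<close>

definition poly_operator ::
    "('a::complex_hilbert_space \<Rightarrow> 'a) \<Rightarrow> real poly \<Rightarrow> ('a \<Rightarrow> 'a) \<Rightarrow> 'a \<Rightarrow> 'a" where
  "poly_operator E p A x = (\<Sum>i\<le>degree p. coeff p i *\<^sub>R (A ^^ i) (E x))"

text \<open>
  For a self-adjoint operator \<open>A\<close> on \<open>range E\<close> and a real function \<open>g\<close> continuous on the spectrum of \<open>A\<close>,
  \<open>g(A)\<close> is the norm limit of \<open>p\<^sub>n(A)\<close> for every sequence of real polynomials \<open>p\<^sub>n\<close> converging to \<open>g\<close>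
  uniformly on the spectrum. Such sequences exist by the Weierstrass theorem, so the limit condition
  determines the operator.
\<close>

definition functional_calculus_on ::
    "('a::complex_hilbert_space \<Rightarrow> 'a) \<Rightarrow> (real \<Rightarrow> real) \<Rightarrow> ('a \<Rightarrow> 'a) \<Rightarrow> 'a \<Rightarrow> 'a" where
  "functional_calculus_on E g A =
    (THE T. operator_on E T \<and>
      (\<forall>p :: nat \<Rightarrow> real poly.
        uniform_limit {t. complex_of_real t \<in> spectrum_on E A} (\<lambda>n. poly (p n)) g sequentially \<longrightarrow>
        (\<lambda>n. onorm (\<lambda>x. poly_operator E (p n) A x - T x)) \<longlonglongrightarrow> 0))"

abbreviation functional_calculus ::
    "(real \<Rightarrow> real) \<Rightarrow> ('a::complex_hilbert_space \<Rightarrow> 'a) \<Rightarrow> 'a \<Rightarrow> 'a" where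
  "functional_calculus \<equiv> functional_calculus_on id"


section \<open>Strongly operator convex functions\<close>

text \<open>
  A quantification over all Hilbert spaces is restricted in HOL to those found in a fixed universe.
  Here they are the closed subspaces \<open>range E\<close> of the space of square-summable sequences in \<open>'u\<close>.
  For nonzero \<open>'u\<close> these include, up to unitary equivalence, all separable Hilbert spaces, \<open>'u\<close> itself,
  and all Hilbert spaces whose dimension is at most that of \<open>'u\<close>.
  The condition \<^term>\<open>operator_on E P\<close> says that \<open>P\<close> is a projection on the Hilbert space \<open>range E\<close>;
  \<open>g(PAP)\<close> is computed on \<open>range P\<close>, where \<open>P A P\<close> represents the compression of \<open>A\<close>.
\<close>

definition SOC :: "'u::complex_hilbert_space itself \<Rightarrow> real set \<Rightarrow> (real \<Rightarrow> real) set" where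
  "SOC _ J = {g. continuous_on J g \<and>
    (\<forall>(E :: 'u ell2 \<Rightarrow> 'u ell2) A P.
      orthogonal_projection E \<longrightarrow>
      operator_on E A \<longrightarrow> self_adjoint A \<longrightarrow> spectrum_on E A \<subseteq> complex_of_real ` J \<longrightarrow>
      operator_on E P \<longrightarrow> orthogonal_projection P \<longrightarrow>
      P \<circ> functional_calculus_on P g (P \<circ> A \<circ> P) \<circ> P \<le>\<^sub>o\<^sub>p functional_calculus_on E g A)}"

end

theory Submission
  imports Defs "HOL-Computational_Algebra.Fundamental_Theorem_Algebra"
begin

text \<open>
  The strongly operator convex functions on a half-line unbounded to the left are operator monotone,
  convex, and strictly increasing unless constant. The three inequalities follow from this. Put
  \<open>\<delta> = inverse (onorm (inv (A - B)))\<close>. Then \<open>A - B \<ge> \<delta>\<close>, because the infimum of the quadratic form of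
  \<open>A - B\<close> lies in its spectrum (\<open>form_ge_inverse_onorm_inv\<close>). Thus \<open>B \<le> A - \<delta>\<close>, and operator
  monotonicity gives \<open>g(A) - g(B) \<ge> g(A) - g(A - \<delta>)\<close>. The right-hand side is the function
  \<open>g t - g (t - \<delta>)\<close> of \<open>A\<close>; since \<open>g\<close> is convex, that function increases with \<open>t\<close>, so on the spectrum
  of \<open>A\<close> it is smallest at \<open>\<tau>\<^sub>A\<close>. Moreover \<open>\<tau>\<^sub>A \<ge> \<tau>\<^sub>B + \<delta>\<close>, so convexity also gives the second
  inequality, and strict monotonicity gives the third.

  Monotonicity has a short proof (\<open>SOC_operator_monotone\<close>). Compressing a direct sum \<open>A \<oplus> C\<close> along a
  diagonal copy of the Hilbert space produces \<open>z A + (1 - z) C\<close> for any \<open>0 < z < 1\<close>. As the interval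
  reaches to \<open>-\<infinity>\<close>, the operator \<open>C\<close> may be chosen so that this is exactly \<open>B\<close>, and the corner of
  the strong convexity inequality reads \<open>z g(B) \<le> g(A)\<close>. Scalar operators give
  convexity. A two by two matrix shows that \<open>g\<close> cannot be constant on an initial part of the half-line
  only (\<open>SOC_strict_mono\<close>).

  The spectral theory behind the functional calculus rests on two facts: a coercive operator is
  invertible (\<open>coercive_imp_inverse\<close>), so that the spectrum of a self-adjoint operator is the set of
  \<open>z\<close> for which \<open>z - A\<close> is not bounded below; and the infimum of the quadratic form is a point of the
  spectrum (\<open>form_infimum_in_spectrum\<close>). Applied to \<open>p(A)\<close>, and combined with a factorization of
  \<open>p - m\<close> into linear factors, they show that \<open>p(A) \<ge> 0\<close> whenever \<open>p \<ge> 0\<close> on the spectrum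
  (\<open>poly_operator_nonneg\<close>), hence that \<open>norm (p(A))\<close> is at most the supremum of \<open>\<bar>p\<bar>\<close> on the spectrum.

  The class of strongly operator convex functions is defined with operators on subspaces of a space of
  sequences in \<open>'h\<close>. Several orthogonal copies of \<open>'h\<close> fit into it, and all objects on
  its subspaces are copies, along isometries, of operators on \<open>'h\<close>, \<open>'h \<times> 'h\<close> and
  \<open>('h \<times> 'h) \<times> ('h \<times> 'h)\<close> (\<open>functional_calculus_on_copy\<close>, \<open>SOC_compression\<close>).
\<close>

section \<open>Bounded operators and quadratic forms\<close>

instance complex_hilbert_space \<subseteq> banach ..

lemma scaleC_scaleR_commute:
  fixes x :: "'a::complex_hilbert_space"
  shows "c *\<^sub>C (r *\<^sub>R x) = r *\<^sub>R (c *\<^sub>C x)"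
  unfolding scaleC_of_real[symmetric] scaleC_scaleC by (simp add: mult.commute)

lemma bounded_linear_scaleC:
  "bounded_linear (\<lambda>x::'a::complex_hilbert_space. c *\<^sub>C x)"
  by (rule bounded_linear_intro[of _ "cmod c"])
    (auto simp: scaleC_add_right scaleC_scaleR_commute norm_scaleC mult.commute)

lemmas scaleC_diff_right = linear_diff[OF bounded_linear.linear[OF bounded_linear_scaleC]]
lemmas scaleC_zero_right = linear_0[OF bounded_linear.linear[OF bounded_linear_scaleC]]
lemmas scaleC_sum_right = linear_sum[OF bounded_linear.linear[OF bounded_linear_scaleC]]

lemma scaleC_zero_left: "0 *\<^sub>C (x::'a::complex_hilbert_space) = 0"
  using scaleC_of_real[of 0 x] by simp

lemma scaleC_minus_left: "(- c) *\<^sub>C (x::'a::complex_hilbert_space) = - (c *\<^sub>C x)"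
  using scaleC_add_left[of "-c" c x] by (simp add: scaleC_zero_left eq_neg_iff_add_eq_0)

lemma inner_scaleC_scaleC_left:
  fixes x y :: "'a::complex_hilbert_space"
  shows "inner (c *\<^sub>C x) y = inner x (cnj c *\<^sub>C y)"
  by (simp add: Re_cinner[symmetric] cinner_scaleC_left cinner_scaleC_right)

lemma bounded_operator_bounded_linear: "bounded_operator A \<Longrightarrow> bounded_linear A"
  and bounded_operator_scaleC: "bounded_operator A \<Longrightarrow> A (c *\<^sub>C x) = c *\<^sub>C A x"
  by (auto simp: bounded_operator_def)

lemma bounded_operator_id: "bounded_operator id" "bounded_operator (\<lambda>x. x)"
  by (auto simp: bounded_operator_def id_def)

lemma bounded_operator_zero: "bounded_operator (\<lambda>x. 0)"
  by (auto simp: bounded_operator_def scaleC_zero_right)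

lemma bounded_operator_add:
  "bounded_operator A \<Longrightarrow> bounded_operator B \<Longrightarrow> bounded_operator (\<lambda>x. A x + B x)"
  by (auto simp: bounded_operator_def bounded_linear_add scaleC_add_right)

lemma bounded_operator_diff:
  "bounded_operator A \<Longrightarrow> bounded_operator B \<Longrightarrow> bounded_operator (\<lambda>x. A x - B x)"
  by (auto simp: bounded_operator_def bounded_linear_sub scaleC_diff_right)

lemma bounded_operator_scaleR:
  "bounded_operator A \<Longrightarrow> bounded_operator (\<lambda>x. r *\<^sub>R A x)"
  by (auto simp: bounded_operator_def bounded_linear_const_scaleR scaleC_scaleR_commute)

lemma bounded_operator_scaleC':
  "bounded_operator A \<Longrightarrow> bounded_operator (\<lambda>x. c *\<^sub>C A x)"
  by (auto simp: bounded_operator_def scaleC_scaleC mult.commute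
      intro: bounded_linear_compose[OF bounded_linear_scaleC])

lemma bounded_operator_compose:
  "bounded_operator A \<Longrightarrow> bounded_operator B \<Longrightarrow> bounded_operator (\<lambda>x. A (B x))"
  by (auto simp: bounded_operator_def intro!: bounded_linear_compose[of A B])

lemma bounded_operator_sum:
  "(\<And>i. i \<in> I \<Longrightarrow> bounded_operator (A i)) \<Longrightarrow> bounded_operator (\<lambda>x. \<Sum>i\<in>I. A i x)"
  by (auto simp: bounded_operator_def scaleC_sum_right intro!: bounded_linear_sum)

lemma bounded_operator_funpow:
  "bounded_operator A \<Longrightarrow> bounded_operator (A ^^ i)"
  by (induction i) (auto simp: bounded_operator_id o_def bounded_operator_compose)

lemmas bounded_operator_intros = bounded_operator_id bounded_operator_zero bounded_operator_add
  bounded_operator_diff bounded_operator_scaleR bounded_operator_scaleC' bounded_operator_sum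
  bounded_operator_funpow

lemma operator_on_id: "operator_on id A \<longleftrightarrow> bounded_operator A"
  by (simp add: operator_on_def)

text \<open>
  For a complex-linear operator, symmetry with respect to the real inner product already gives
  self-adjointness, because the imaginary part of the complex inner product is a real inner product
  with a rotated vector. All estimates can therefore be made with the real inner product.
\<close>

lemma self_adjoint_iff_inner:
  "self_adjoint A \<longleftrightarrow> bounded_operator A \<and> (\<forall>x y. inner (A x) y = inner x (A y))"
proof
  assume "self_adjoint A"
  then show "bounded_operator A \<and> (\<forall>x y. inner (A x) y = inner x (A y))"
    by (auto simp: self_adjoint_def Re_cinner[symmetric])
next
  assume A: "bounded_operator A \<and> (\<forall>x y. inner (A x) y = inner x (A y))"
  have "cinner (A x) y = cinner x (A y)" for x y
  proof (rule complex_eqI)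
    show "Re (cinner (A x) y) = Re (cinner x (A y))"
      using A by (simp add: Re_cinner)
    show "Im (cinner (A x) y) = Im (cinner x (A y))"
      using A bounded_operator_scaleC[of A "-\<i>" x] by (metis Im_cinner)
  qed
  then show "self_adjoint A"
    using A by (simp add: self_adjoint_def)
qed

lemma self_adjoint_bounded_operator: "self_adjoint A \<Longrightarrow> bounded_operator A"
  and self_adjoint_inner: "self_adjoint A \<Longrightarrow> inner (A x) y = inner x (A y)"
  by (simp_all add: self_adjoint_iff_inner)

lemma self_adjoint_bounded_linear: "self_adjoint A \<Longrightarrow> bounded_linear A"
  by (simp add: bounded_operator_bounded_linear self_adjoint_bounded_operator)

lemma self_adjoint_id: "self_adjoint id" "self_adjoint (\<lambda>x. x)"
  by (auto simp: self_adjoint_iff_inner bounded_operator_intros)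

lemma self_adjoint_add:
  "self_adjoint A \<Longrightarrow> self_adjoint B \<Longrightarrow> self_adjoint (\<lambda>x. A x + B x)"
  by (auto simp: self_adjoint_iff_inner inner_add_left inner_add_right bounded_operator_add)

lemma self_adjoint_diff:
  "self_adjoint A \<Longrightarrow> self_adjoint B \<Longrightarrow> self_adjoint (\<lambda>x. A x - B x)"
  by (auto simp: self_adjoint_iff_inner inner_diff_left inner_diff_right bounded_operator_diff)

lemma self_adjoint_scaleR: "self_adjoint A \<Longrightarrow> self_adjoint (\<lambda>x. r *\<^sub>R A x)"
  by (auto simp: self_adjoint_iff_inner bounded_operator_scaleR)

lemma self_adjoint_diff_scaleR: "self_adjoint A \<Longrightarrow> self_adjoint (\<lambda>x. A x - r *\<^sub>R x)"
  using self_adjoint_diff[OF _ self_adjoint_scaleR[OF self_adjoint_id(2)]] by blast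

lemma self_adjoint_funpow: "self_adjoint A \<Longrightarrow> self_adjoint (A ^^ i)"
proof (induction i)
  case (Suc i)
  then have IH: "self_adjoint (A ^^ i)" by blast
  have "inner (A ((A ^^ i) x)) y = inner x (A ((A ^^ i) y))" for x y
    by (metis self_adjoint_inner[OF IH] self_adjoint_inner[OF Suc.prems] funpow_swap1)
  then show ?case
    using bounded_operator_funpow[OF self_adjoint_bounded_operator[OF Suc.prems], of "Suc i"]
    by (simp add: self_adjoint_iff_inner o_def)
qed (simp add: self_adjoint_id)

lemma self_adjoint_sum:
  "(\<And>i. i \<in> I \<Longrightarrow> self_adjoint (A i)) \<Longrightarrow> self_adjoint (\<lambda>x. \<Sum>i\<in>I. A i x)"
  by (auto simp: self_adjoint_iff_inner inner_sum_left inner_sum_right intro!: bounded_operator_sum)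

lemma positive_operator_inner: "positive_operator A \<Longrightarrow> 0 \<le> inner (A x) x"
  by (auto simp: positive_operator_def complex_nonneg_Reals_iff Re_cinner[symmetric])

lemma positive_operatorI:
  assumes "self_adjoint A" "\<And>x. 0 \<le> inner (A x) x"
  shows "positive_operator A"
proof -
  have "Im (cinner (A x) x) = 0" for x
    using assms(1) cinner_commute[of "A x" x] by (metis cnj.simps(2) neg_equal_zero self_adjoint_def)
  then show ?thesis
    using assms by (auto simp: positive_operator_def self_adjoint_bounded_operator
        complex_nonneg_Reals_iff Re_cinner)
qed

text \<open>Polarization turns a bound of the quadratic form into a bound of the operator.\<close>

lemma norm_le_of_form_le:
  fixes T :: "'a::complex_hilbert_space \<Rightarrow> 'a"
  assumes T: "self_adjoint T" and M: "M > 0" and form: "\<And>x. \<bar>inner (T x) x\<bar> \<le> M * (norm x)\<^sup>2"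
  shows "norm (T x) \<le> M * norm x"
proof -
  interpret bounded_linear T
    using T by (rule self_adjoint_bounded_linear)
  \<comment> \<open>With this \<open>y\<close>, both \<open>inner (T x) y\<close> and \<open>M * (norm y)\<^sup>2\<close> equal \<open>(norm (T x))\<^sup>2 / M\<close>.\<close>
  define y where "y = (1 / M) *\<^sub>R T x"
  have "4 * inner (T x) y = inner (T (x + y)) (x + y) - inner (T (x - y)) (x - y)"
  proof -
    have "inner (T y) x = inner (T x) y"
      by (metis self_adjoint_inner[OF T] inner_commute)
    then show ?thesis
      unfolding add diff inner_add_left inner_add_right inner_diff_left inner_diff_right by linarith
  qed
  also have "\<dots> \<le> M * (norm (x + y))\<^sup>2 + M * (norm (x - y))\<^sup>2"
    using form[of "x + y"] form[of "x - y"] by linarith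
  also have "\<dots> = 2 * M * (norm x)\<^sup>2 + 2 * M * (norm y)\<^sup>2"
    unfolding power2_norm_eq_inner inner_add_left inner_add_right inner_diff_left inner_diff_right
      inner_commute[of y x] by (simp add: algebra_simps)
  finally have "4 * inner (T x) y \<le> 2 * M * (norm x)\<^sup>2 + 2 * M * (norm y)\<^sup>2" .
  moreover have "inner (T x) y = (norm (T x))\<^sup>2 / M" "M * (norm y)\<^sup>2 = (norm (T x))\<^sup>2 / M"
    using M by (simp_all add: y_def power2_norm_eq_inner field_simps) (simp_all add: power2_eq_square)
  ultimately have "(norm (T x))\<^sup>2 / M \<le> M * (norm x)\<^sup>2"
    by linarith
  then have "(norm (T x))\<^sup>2 \<le> (M * norm x)\<^sup>2"
    using M by (simp add: field_simps power2_eq_square)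
  then show ?thesis
    by (rule power2_le_imp_le) (use M in simp)
qed


section \<open>The spectrum of a self-adjoint operator\<close>

text \<open>
  A bounded coercive operator is invertible: for a large constant \<open>L\<close> the map
  \<open>x \<mapsto> x - (T x - y) / L\<close> is a contraction, and its fixed point solves \<open>T x = y\<close>.
\<close>

lemma coercive_imp_inverse:
  fixes T :: "'a::complex_hilbert_space \<Rightarrow> 'a"
  assumes T: "bounded_operator T" and c: "c > 0"
    and coercive: "\<And>x. c * (norm x)\<^sup>2 \<le> inner (T x) x"
  shows "\<exists>S. bounded_operator S \<and> (\<forall>x. T (S x) = x) \<and> (\<forall>x. S (T x) = x)"
proof -
  interpret T: bounded_linear T
    using T by (rule bounded_operator_bounded_linear)
  obtain K0 where K0: "K0 > 0" "\<And>x. norm (T x) \<le> norm x * K0"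
    using T.pos_bounded by blast
  define K where "K = K0 + c"
  have K: "K > 0" "K \<ge> c"
    using K0(1) c by (simp_all add: K_def)
  have norm_T: "norm (T x) \<le> K * norm x" for x
  proof -
    have "0 \<le> c * norm x" using c by simp
    then show ?thesis
      using K0(2)[of x] by (simp add: K_def algebra_simps)
  qed
  have below: "c * norm x \<le> norm (T x)" for x
  proof (cases "x = 0")
    case False
    have "c * norm x * norm x \<le> norm (T x) * norm x"
      using coercive[of x] norm_cauchy_schwarz[of "T x" x] by (simp add: power2_eq_square)
    then show ?thesis
      using False by simp
  qed simp
  \<comment> \<open>The square of the contraction constant is at most \<open>1 - 2 c / L + K\<^sup>2 / L\<^sup>2\<close>, which is smallest for this \<open>L\<close>.\<close>
  define L where "L = K\<^sup>2 / c"
  have L: "L > 0"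
    using K c by (simp add: L_def)
  define q where "q = sqrt (1 - c\<^sup>2 / K\<^sup>2)"
  have q: "0 \<le> q" "q < 1" "q\<^sup>2 = 1 - c\<^sup>2 / K\<^sup>2"
    using K c by (auto simp: q_def power_mono)
  have contr: "norm (x - (1 / L) *\<^sub>R T x) \<le> q * norm x" for x
  proof -
    have "(norm (x - (1 / L) *\<^sub>R T x))\<^sup>2 = (norm x)\<^sup>2 - 2 / L * inner (T x) x + (norm (T x))\<^sup>2 / L\<^sup>2"
      unfolding power2_norm_eq_inner inner_diff_left inner_diff_right inner_scaleR_left
        inner_scaleR_right inner_commute[of x "T x"] by (simp add: power2_eq_square diff_divide_distrib)
    also have "\<dots> \<le> (norm x)\<^sup>2 - 2 / L * (c * (norm x)\<^sup>2) + (K * norm x)\<^sup>2 / L\<^sup>2"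
      using coercive[of x] norm_T[of x] L
      by (intro add_mono diff_mono mult_left_mono divide_right_mono power_mono) auto
    also have "\<dots> = (q * norm x)\<^sup>2"
      unfolding power_mult_distrib q(3) using K c
      by (simp add: L_def field_simps) (simp add: power2_eq_square)
    finally show ?thesis
      by (rule power2_le_imp_le) (use q in simp)
  qed
  have ex: "\<exists>x. T x = y" for y
  proof -
    have "\<exists>!x. x - (1 / L) *\<^sub>R (T x - y) = x"
    proof (rule banach_fix_type[of q])
      show "0 \<le> q" "q < 1" by (fact q)+
      show "\<forall>x z. dist (x - (1 / L) *\<^sub>R (T x - y)) (z - (1 / L) *\<^sub>R (T z - y)) \<le> q * dist x z"
      proof (intro allI)
        fix x z
        have "x - (1 / L) *\<^sub>R (T x - y) - (z - (1 / L) *\<^sub>R (T z - y)) = (x - z) - (1 / L) *\<^sub>R T (x - z)"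
          by (simp add: T.diff algebra_simps)
        then show "dist (x - (1 / L) *\<^sub>R (T x - y)) (z - (1 / L) *\<^sub>R (T z - y)) \<le> q * dist x z"
          using contr[of "x - z"] by (simp only: dist_norm)
      qed
    qed
    then obtain x where "x - (1 / L) *\<^sub>R (T x - y) = x" by blast
    then show ?thesis
      using L by auto
  qed
  define S where "S y = (SOME x. T x = y)" for y
  have TS: "T (S y) = y" for y
    unfolding S_def using ex[of y] by (rule someI_ex)
  have inj: "x = z" if "T x = T z" for x z
    using below[of "x - z"] that c by (simp add: T.diff mult_le_0_iff)
  have "bounded_linear S"
  proof (rule bounded_linear_intro[of _ "1 / c"])
    show "S (x + y) = S x + S y" for x y
      by (rule inj) (simp add: TS T.add)
    show "S (r *\<^sub>R x) = r *\<^sub>R S x" for r x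
      by (rule inj) (simp add: TS T.scaleR)
    show "norm (S x) \<le> norm x * (1 / c)" for x
      using below[of "S x"] c by (simp add: TS field_simps)
  qed
  moreover have "S (a *\<^sub>C x) = a *\<^sub>C S x" for a x
    by (rule inj) (simp add: TS bounded_operator_scaleC[OF T])
  ultimately show ?thesis
    using TS inj by (auto simp: bounded_operator_def)
qed

definition bounded_below :: "('a::real_normed_vector \<Rightarrow> 'b::real_normed_vector) \<Rightarrow> bool" where
  "bounded_below T \<longleftrightarrow> (\<exists>c>0. \<forall>x. c * norm x \<le> norm (T x))"

lemma invertible_on_id:
  "invertible_on id T \<longleftrightarrow> (\<exists>S. bounded_operator S \<and> (\<forall>x. T (S x) = x) \<and> (\<forall>x. S (T x) = x))"
  by (auto simp: invertible_on_def operator_on_id fun_eq_iff)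

lemma inverse_imp_bounded_below:
  assumes "bounded_linear S" "\<And>x. S (T x) = x"
  shows "bounded_below T"
proof -
  obtain K where "K > 0" "\<And>x. norm (S x) \<le> norm x * K"
    using bounded_linear.pos_bounded[OF assms(1)] by blast
  then have "\<forall>x. 1 / K * norm x \<le> norm (T x)"
    using assms(2) by (metis divide_le_eq mult.left_neutral times_divide_eq_left)
  then show ?thesis
    unfolding bounded_below_def using \<open>K > 0\<close> by (intro exI[of _ "1 / K"]) simp
qed

text \<open>
  A self-adjoint operator has no residual spectrum. With \<open>N = z - A\<close>, which is normal, the operator
  \<open>N\<^sup>* N = N N\<^sup>*\<close> is coercive when \<open>N\<close> is bounded below, so it has an inverse \<open>S\<close>, and \<open>N\<^sup>* S\<close>
  inverts \<open>N\<close>.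
\<close>

lemma spectrum_iff_not_bounded_below:
  fixes A :: "'a::complex_hilbert_space \<Rightarrow> 'a"
  assumes A: "self_adjoint A"
  shows "z \<in> spectrum A \<longleftrightarrow> \<not> bounded_below (\<lambda>x. z *\<^sub>C x - A x)"
proof -
  have "invertible_on id (\<lambda>x. z *\<^sub>C x - A x)" if bb: "bounded_below (\<lambda>x. z *\<^sub>C x - A x)"
  proof -
    note bA = self_adjoint_bounded_operator[OF A]
    interpret A: bounded_linear A
      using A by (rule self_adjoint_bounded_linear)
    define N where "N x = z *\<^sub>C x - A x" for x
    define N' where "N' x = cnj z *\<^sub>C x - A x" for x
    have bN: "bounded_operator N" "bounded_operator N'"
      unfolding N_def N'_def by (intro bounded_operator_intros bA)+
    have comm: "N (N' x) = N' (N x)" for x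
      by (simp add: N_def N'_def A.diff bounded_operator_scaleC[OF bA] scaleC_diff_right scaleC_scaleC
          mult.commute)
    obtain c where c: "c > 0" "\<And>x. c * norm x \<le> norm (N x)"
      using bb by (auto simp: bounded_below_def N_def)
    have "c\<^sup>2 * (norm x)\<^sup>2 \<le> inner (N' (N x)) x" for x
    proof -
      have "inner (N' (N x)) x = (norm (N x))\<^sup>2"
        unfolding power2_norm_eq_inner N'_def
        by (subst (3) N_def)
          (simp add: inner_diff_left inner_diff_right inner_scaleC_scaleC_left self_adjoint_inner[OF A])
      moreover have "(c * norm x)\<^sup>2 \<le> (norm (N x))\<^sup>2"
        using c by (intro power_mono) auto
      ultimately show ?thesis
        by (simp add: power_mult_distrib)
    qed
    then obtain S where S: "bounded_operator S" "\<And>x. N' (N (S x)) = x" "\<And>x. S (N' (N x)) = x"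
      using coercive_imp_inverse[of "\<lambda>x. N' (N x)" "c\<^sup>2"] bN c bounded_operator_compose[OF bN(2,1)] by auto
    have "S (N' x) = N' (S x)" for x
      using S comm by metis
    then have "\<And>x. N (N' (S x)) = x" "\<And>x. N' (S (N x)) = x"
      using S comm by metis+
    then show ?thesis
      unfolding invertible_on_id using bounded_operator_compose[OF bN(2) S(1)]
      by (intro exI[of _ "\<lambda>x. N' (S x)"]) (auto simp: N_def)
  qed
  moreover have "bounded_below (\<lambda>x. z *\<^sub>C x - A x)" if inv: "invertible_on id (\<lambda>x. z *\<^sub>C x - A x)"
  proof -
    obtain S where S: "bounded_operator S" "\<And>x. S (z *\<^sub>C x - A x) = x"
      using inv unfolding invertible_on_id by blast
    show ?thesis
      using inverse_imp_bounded_below[OF bounded_operator_bounded_linear[OF S(1)] S(2)] .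
  qed
  ultimately show ?thesis
    by (auto simp: spectrum_on_def)
qed

abbreviation real_spectrum :: "('a::complex_hilbert_space \<Rightarrow> 'a) \<Rightarrow> real set" where
  "real_spectrum A \<equiv> {t. complex_of_real t \<in> spectrum A}"

lemma real_spectrum_iff:
  assumes "self_adjoint A"
  shows "t \<in> real_spectrum A \<longleftrightarrow> \<not> bounded_below (\<lambda>x. A x - t *\<^sub>R x)"
  by (simp add: spectrum_iff_not_bounded_below[OF assms] scaleC_of_real bounded_below_def
      norm_minus_commute)

text \<open>
  For self-adjoint \<open>A\<close>, the imaginary part of the form of \<open>z - A\<close> at \<open>x\<close> is \<open>Im z * (norm x)\<^sup>2\<close>, so
  \<open>z - A\<close> is bounded below by \<open>\<bar>Im z\<bar>\<close>.
\<close>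

lemma spectrum_real:
  assumes A: "self_adjoint A" and z: "z \<in> spectrum A"
  shows "z \<in> \<real>"
proof (rule ccontr)
  assume "z \<notin> \<real>"
  then have Im: "Im z \<noteq> 0"
    by (simp add: complex_is_Real_iff)
  have "\<bar>Im z\<bar> * norm x \<le> norm (z *\<^sub>C x - A x)" for x
  proof (cases "x = 0")
    case False
    define u where "u = z *\<^sub>C x - A x"
    have "Im (cinner (A x) x) = 0"
      using A cinner_commute[of "A x" x] by (metis cnj.simps(2) neg_equal_zero self_adjoint_def)
    moreover have "cinner u x + cinner (A x) x = z * cinner x x"
      unfolding u_def by (simp add: cinner_add_left[symmetric] cinner_scaleC_left)
    ultimately have "Im (cinner u x) = Im z * (norm x)\<^sup>2"
      by (metis (no_types, lifting) Im_complex_of_real Re_complex_of_real add.right_neutral cinner_self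
          mult_zero_right plus_complex.sel(2) times_complex.sel(2) add.left_neutral)
    moreover have "\<bar>Im (cinner u x)\<bar> \<le> norm u * norm x"
      using Cauchy_Schwarz_ineq2[of "(-\<i>) *\<^sub>C u" x] unfolding Im_cinner
      by (simp add: norm_scaleC)
    ultimately have "\<bar>Im z\<bar> * norm x * norm x \<le> norm u * norm x"
      by (simp add: abs_mult power2_eq_square mult.assoc)
    then show ?thesis
      using False by (simp add: u_def)
  qed simp
  then have "bounded_below (\<lambda>x. z *\<^sub>C x - A x)"
    using Im unfolding bounded_below_def by (intro exI[of _ "\<bar>Im z\<bar>"]) auto
  then show False
    using z by (simp add: spectrum_iff_not_bounded_below[OF A])
qed

lemma real_spectrum_ge:
  assumes A: "self_adjoint A" and m: "\<And>x. m * (norm x)\<^sup>2 \<le> inner (A x) x" and t: "t \<in> real_spectrum A"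
  shows "m \<le> t"
proof (rule ccontr)
  assume "\<not> m \<le> t"
  have "(m - t) * norm x \<le> norm (A x - t *\<^sub>R x)" for x
  proof (cases "x = 0")
    case False
    have "(m - t) * norm x * norm x \<le> inner (A x - t *\<^sub>R x) x"
      using m[of x] by (simp add: inner_diff_left power2_norm_eq_inner[symmetric] power2_eq_square
          algebra_simps)
    also have "\<dots> \<le> norm (A x - t *\<^sub>R x) * norm x"
      by (rule norm_cauchy_schwarz)
    finally show ?thesis
      using False by simp
  qed simp
  then have "bounded_below (\<lambda>x. A x - t *\<^sub>R x)"
    using \<open>\<not> m \<le> t\<close> unfolding bounded_below_def by (intro exI[of _ "m - t"]) auto
  then show False
    using t real_spectrum_iff[OF A] by blast
qed

lemma real_spectrum_uminus:
  assumes "self_adjoint A"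
  shows "t \<in> real_spectrum (\<lambda>x. - A x) \<longleftrightarrow> - t \<in> real_spectrum A"
proof -
  have "self_adjoint (\<lambda>x. - A x)"
    using self_adjoint_scaleR[OF assms, of "-1"] by simp
  moreover have "norm (- A x - t *\<^sub>R x) = norm (A x - (- t) *\<^sub>R x)" for x
    by (metis diff_minus_eq_add minus_add_distrib norm_minus_cancel scaleR_minus_left
        uminus_add_conv_diff add.commute)
  ultimately show ?thesis
    using assms by (simp only: real_spectrum_iff bounded_below_def)
qed

lemma real_spectrum_le:
  assumes A: "self_adjoint A" and M: "\<And>x. inner (A x) x \<le> M * (norm x)\<^sup>2" and t: "t \<in> real_spectrum A"
  shows "t \<le> M"
proof -
  have "self_adjoint (\<lambda>x. - A x)"
    using self_adjoint_scaleR[OF A, of "-1"] by simp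
  moreover have "- M * (norm x)\<^sup>2 \<le> inner (- A x) x" for x
    using M[of x] by simp
  moreover have "- t \<in> real_spectrum (\<lambda>x. - A x)"
    unfolding real_spectrum_uminus[OF A] using t by simp
  ultimately have "- M \<le> - t"
    by (rule real_spectrum_ge)
  then show ?thesis by simp
qed

text \<open>
  The greatest lower bound \<open>m\<close> of the quadratic form belongs to the spectrum. For a positive operator
  \<open>T\<close> with \<open>norm T \<le> K\<close> one has \<open>norm (T x)\<^sup>2 \<le> K * inner (T x) x\<close>; if \<open>T = A - m\<close> were bounded below,
  its form would therefore be bounded below by a positive constant.
\<close>

lemma form_infimum_in_spectrum:
  fixes A :: "'a::complex_hilbert_space \<Rightarrow> 'a"
  assumes nz: "\<exists>x::'a. x \<noteq> 0" and A: "self_adjoint A"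
  shows "\<exists>m\<in>real_spectrum A. \<forall>x. m * (norm x)\<^sup>2 \<le> inner (A x) x"
proof -
  interpret A: bounded_linear A
    using A by (rule self_adjoint_bounded_linear)
  obtain K where K: "K > 0" "\<And>x. norm (A x) \<le> norm x * K"
    using A.pos_bounded by blast
  define F where "F = (\<lambda>x. inner (A x) x) ` {x. norm x = 1}"
  have "bdd_below F"
  proof (rule bdd_belowI)
    fix y assume "y \<in> F"
    then obtain x where "norm x = 1" "y = inner (A x) x" by (auto simp: F_def)
    then show "- K \<le> y"
      using Cauchy_Schwarz_ineq2[of "A x" x] K(2)[of x] by auto
  qed
  obtain x0 :: 'a where "x0 \<noteq> 0" using nz by blast
  then have "norm ((1 / norm x0) *\<^sub>R x0) = 1" by simp
  then have "F \<noteq> {}"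
    unfolding F_def by blast
  define m where "m = Inf F"
  have lower: "m * (norm x)\<^sup>2 \<le> inner (A x) x" for x
  proof (cases "x = 0")
    case False
    define u where "u = (1 / norm x) *\<^sub>R x"
    have "norm u = 1" using False by (simp add: u_def)
    then have "m \<le> inner (A u) u"
      unfolding m_def by (intro cInf_lower[OF _ \<open>bdd_below F\<close>]) (auto simp: F_def)
    also have "\<dots> = inner (A x) x / (norm x)\<^sup>2"
      by (simp add: u_def A.scaleR power2_eq_square)
    finally show ?thesis
      using False by (simp add: field_simps)
  qed simp
  have "m \<in> real_spectrum A"
  proof (rule ccontr)
    assume "m \<notin> real_spectrum A"
    then obtain c where c: "c > 0" "\<And>x. c * norm x \<le> norm (A x - m *\<^sub>R x)"
      unfolding real_spectrum_iff[OF A] bounded_below_def by blast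
    define T where "T x = A x - m *\<^sub>R x" for x
    have T: "self_adjoint T"
      unfolding T_def by (rule self_adjoint_diff_scaleR[OF A])
    interpret T: bounded_linear T
      using T by (rule self_adjoint_bounded_linear)
    obtain L where L: "L > 0" "\<And>x. norm (T x) \<le> norm x * L"
      using T.pos_bounded by blast
    have pos: "0 \<le> inner (T x) x" for x
      using lower[of x] by (simp add: T_def inner_diff_left power2_norm_eq_inner)
    have sq: "(norm (T x))\<^sup>2 \<le> L * inner (T x) x" for x
    proof -
      \<comment> \<open>The form is nonnegative at \<open>x - r T x\<close> for every \<open>r\<close>; the best choice is \<open>r = 1 / L\<close>.\<close>
      define y where "y = (1 / L) *\<^sub>R T x"
      have "0 \<le> inner (T (x - y)) (x - y)" by (rule pos)
      also have "\<dots> = inner (T x) x - 2 * inner (T x) y + inner (T y) y"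
      proof -
        have "inner (T y) x = inner (T x) y"
          by (metis self_adjoint_inner[OF T] inner_commute)
        then show ?thesis
          unfolding T.diff inner_diff_left inner_diff_right by linarith
      qed
      also have "inner (T y) y \<le> norm y * L * norm y"
        using norm_cauchy_schwarz[of "T y" y] L(2)[of y]
        by (meson mult_right_mono norm_ge_zero order_trans)
      finally show ?thesis
        using L(1) by (simp add: y_def power2_norm_eq_inner[symmetric] power2_eq_square field_simps)
    qed
    have "m + c\<^sup>2 / L \<le> y" if y: "y \<in> F" for y
    proof -
      obtain x where x: "norm x = 1" "y = inner (A x) x" using y by (auto simp: F_def)
      have "c\<^sup>2 \<le> (norm (T x))\<^sup>2"
        using c(1) c(2)[of x] x by (intro power_mono) (auto simp: T_def)
      also have "\<dots> \<le> L * (y - m)"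
        using sq[of x] x by (simp add: T_def inner_diff_left power2_norm_eq_inner[symmetric])
      finally show ?thesis
        using L by (simp add: field_simps)
    qed
    then have "m + c\<^sup>2 / L \<le> m"
      unfolding m_def using \<open>F \<noteq> {}\<close> by (intro cInf_greatest) auto
    then show False
      using c L by (simp add: field_simps)
  qed
  then show ?thesis
    using lower by blast
qed

lemma form_supremum_in_spectrum:
  fixes A :: "'a::complex_hilbert_space \<Rightarrow> 'a"
  assumes nz: "\<exists>x::'a. x \<noteq> 0" and A: "self_adjoint A"
  shows "\<exists>M\<in>real_spectrum A. \<forall>x. inner (A x) x \<le> M * (norm x)\<^sup>2"
proof -
  have "self_adjoint (\<lambda>x. - A x)"
    using self_adjoint_scaleR[OF A, of "-1"] by simp
  then obtain m where m: "m \<in> real_spectrum (\<lambda>x. - A x)" "\<forall>x. m * (norm x)\<^sup>2 \<le> inner (- A x) x"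
    using form_infimum_in_spectrum[OF nz] by blast
  have "- m \<in> real_spectrum A"
    using m(1) real_spectrum_uminus[OF A, of m] by blast
  moreover have "inner (A x) x \<le> - m * (norm x)\<^sup>2" for x
    using m(2)[rule_format, of x] by simp
  ultimately show ?thesis
    by blast
qed

lemma min_spectrum_props:
  fixes A :: "'a::complex_hilbert_space \<Rightarrow> 'a"
  assumes nz: "\<exists>x::'a. x \<noteq> 0" and A: "self_adjoint A"
  shows min_spectrum_in_spectrum: "min_spectrum A \<in> real_spectrum A"
    and min_spectrum_le_form: "min_spectrum A * (norm x)\<^sup>2 \<le> inner (A x) x"
proof -
  obtain m where m: "m \<in> real_spectrum A" "\<forall>x. m * (norm x)\<^sup>2 \<le> inner (A x) x"
    using form_infimum_in_spectrum[OF assms] by blast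
  have "min_spectrum A = m"
    unfolding min_spectrum_def
    by (rule Least_equality) (use m real_spectrum_ge[OF A] in auto)
  then show "min_spectrum A \<in> real_spectrum A" "min_spectrum A * (norm x)\<^sup>2 \<le> inner (A x) x"
    using m by auto
qed

text \<open>
  The supremum of the form is a point of the spectrum, so it is less than \<open>b\<close> when the spectrum is.
  In terms of forms it is evident that the condition passes to smaller operators, to compressions
  and to direct sums.
\<close>

lemma spectrum_lessThan_iff_form:
  fixes A :: "'a::complex_hilbert_space \<Rightarrow> 'a"
  assumes nz: "\<exists>x::'a. x \<noteq> 0" and A: "self_adjoint A"
  shows "spectrum A \<subseteq> complex_of_real ` {..<b} \<longleftrightarrow> (\<exists>M<b. \<forall>x. inner (A x) x \<le> M * (norm x)\<^sup>2)"
proof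
  assume sp: "spectrum A \<subseteq> complex_of_real ` {..<b}"
  obtain M where M: "M \<in> real_spectrum A" "\<forall>x. inner (A x) x \<le> M * (norm x)\<^sup>2"
    using form_supremum_in_spectrum[OF assms] by blast
  then have "M < b"
    using sp by auto
  then show "\<exists>M<b. \<forall>x. inner (A x) x \<le> M * (norm x)\<^sup>2"
    using M by blast
next
  assume "\<exists>M<b. \<forall>x. inner (A x) x \<le> M * (norm x)\<^sup>2"
  then obtain M where M: "M < b" "\<And>x. inner (A x) x \<le> M * (norm x)\<^sup>2" by blast
  show "spectrum A \<subseteq> complex_of_real ` {..<b}"
  proof
    fix z assume z: "z \<in> spectrum A"
    then obtain t where t: "z = complex_of_real t"
      using spectrum_real[OF A] by (auto elim: Reals_cases)
    then have "t \<le> M"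
      using z by (intro real_spectrum_le[OF A M(2)]) auto
    then show "z \<in> complex_of_real ` {..<b}"
      using t M by auto
  qed
qed

lemma compact_real_spectrum:
  fixes A :: "'a::complex_hilbert_space \<Rightarrow> 'a"
  assumes nz: "\<exists>x::'a. x \<noteq> 0" and A: "self_adjoint A"
  shows "compact (real_spectrum A)"
proof -
  obtain m M where mM: "\<And>x. m * (norm x)\<^sup>2 \<le> inner (A x) x" "\<And>x. inner (A x) x \<le> M * (norm x)\<^sup>2"
    using form_infimum_in_spectrum[OF assms] form_supremum_in_spectrum[OF assms] by blast
  have "real_spectrum A \<subseteq> {m..M}"
    using real_spectrum_ge[OF A mM(1)] real_spectrum_le[OF A mM(2)] by auto
  then have "bounded (real_spectrum A)"
    by (rule bounded_subset[rotated]) simp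
  moreover have "open (- real_spectrum A)"
  proof (rule openI)
    fix t assume "t \<in> - real_spectrum A"
    then obtain c where c: "c > 0" "\<And>x. c * norm x \<le> norm (A x - t *\<^sub>R x)"
      unfolding Compl_iff real_spectrum_iff[OF A] bounded_below_def by blast
    have "s \<notin> real_spectrum A" if s: "s \<in> ball t (c / 2)" for s
    proof -
      have "c / 2 * norm x \<le> norm (A x - s *\<^sub>R x)" for x
      proof -
        have "norm (A x - t *\<^sub>R x) \<le> norm (A x - s *\<^sub>R x) + norm ((s - t) *\<^sub>R x)"
          using norm_triangle_ineq[of "A x - s *\<^sub>R x" "(s - t) *\<^sub>R x"] by (simp add: algebra_simps)
        moreover have "norm ((s - t) *\<^sub>R x) \<le> c / 2 * norm x"
          unfolding norm_scaleR by (rule mult_right_mono) (use s in \<open>auto simp: dist_real_def abs_minus_commute\<close>)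
        ultimately show ?thesis
          using c(2)[of x] by (simp add: field_simps)
      qed
      then show ?thesis
        unfolding real_spectrum_iff[OF A] bounded_below_def
        using c(1) by (auto intro!: exI[of _ "c / 2"])
    qed
    then show "\<exists>e>0. ball t e \<subseteq> - real_spectrum A"
      using c(1) by (intro exI[of _ "c / 2"]) auto
  qed
  ultimately show ?thesis
    by (simp add: compact_eq_bounded_closed closed_def)
qed

section \<open>Polynomials of a self-adjoint operator\<close>

text \<open>
  Polynomials with complex coefficients are needed because the positivity argument below factors a
  polynomial into linear factors.
\<close>

definition complex_poly_operator ::
    "('a::complex_hilbert_space \<Rightarrow> 'a) \<Rightarrow> complex poly \<Rightarrow> 'a \<Rightarrow> 'a" where
  "complex_poly_operator A q x = (\<Sum>i\<le>degree q. coeff q i *\<^sub>C (A ^^ i) x)"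

lemma scaleC_diff_left: "(a - b) *\<^sub>C (x::'a::complex_hilbert_space) = a *\<^sub>C x - b *\<^sub>C x"
  using scaleC_add_left[of a "-b" x] by (simp add: scaleC_minus_left)

lemma complex_poly_operator_eq_sum:
  assumes "degree q \<le> N"
  shows "complex_poly_operator A q x = (\<Sum>i\<le>N. coeff q i *\<^sub>C (A ^^ i) x)"
  unfolding complex_poly_operator_def
  by (rule sum.mono_neutral_left) (use assms in \<open>auto simp: coeff_eq_0 scaleC_zero_left\<close>)

lemma complex_poly_operator_linear_factor:
  assumes A: "bounded_operator A"
  shows "complex_poly_operator A ([:- z, 1:] * r) x =
    A (complex_poly_operator A r x) - z *\<^sub>C complex_poly_operator A r x"
proof -
  define N where "N = degree r"
  have lin: "linear A"
    using A by (intro bounded_linear.linear bounded_operator_bounded_linear)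
  have q: "[:- z, 1:] * r = pCons 0 r - smult z r"
    by simp
  have "degree ([:- z, 1:] * r) \<le> Suc N"
    using degree_mult_le[of "[:- z, 1:]" r] by (simp add: N_def)
  then have "complex_poly_operator A ([:- z, 1:] * r) x =
      (\<Sum>i\<le>Suc N. (coeff (pCons 0 r) i - z * coeff r i) *\<^sub>C (A ^^ i) x)"
    by (subst complex_poly_operator_eq_sum) (auto simp only: q coeff_diff coeff_smult)
  also have "\<dots> = (\<Sum>i\<le>Suc N. coeff (pCons 0 r) i *\<^sub>C (A ^^ i) x)
      - z *\<^sub>C (\<Sum>i\<le>Suc N. coeff r i *\<^sub>C (A ^^ i) x)"
    unfolding scaleC_diff_left sum_subtractf scaleC_sum_right scaleC_scaleC ..
  also have "(\<Sum>i\<le>Suc N. coeff r i *\<^sub>C (A ^^ i) x) = complex_poly_operator A r x"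
    by (rule complex_poly_operator_eq_sum[symmetric]) (simp add: N_def)
  also have "(\<Sum>i\<le>Suc N. coeff (pCons 0 r) i *\<^sub>C (A ^^ i) x) = A (complex_poly_operator A r x)"
    unfolding sum.atMost_Suc_shift
    by (simp add: scaleC_zero_left complex_poly_operator_def linear_sum[OF lin] N_def
        bounded_operator_scaleC[OF A])
  finally show ?thesis .
qed

text \<open>Each linear factor is bounded below, hence so is the product.\<close>

lemma complex_poly_operator_bounded_below:
  assumes A: "self_adjoint A" and "q \<noteq> 0" and "\<And>z. poly q z = 0 \<Longrightarrow> z \<notin> spectrum A"
  shows "bounded_below (complex_poly_operator A q)"
  using assms(2,3)
proof (induction "degree q" arbitrary: q)
  case 0
  then obtain c where c: "q = [:c:]" "c \<noteq> 0"
    by (metis degree_eq_zeroE pCons_0_0)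
  then show ?case
    by (auto simp: bounded_below_def complex_poly_operator_def norm_scaleC intro!: exI[of _ "cmod c"])
next
  case (Suc n)
  have "\<not> constant (poly q)"
    using Suc.hyps(2) by (simp add: constant_degree)
  then obtain z where z: "poly q z = 0"
    using fundamental_theorem_of_algebra by blast
  then obtain r where r: "q = [:- z, 1:] * r"
    by (auto simp: poly_eq_0_iff_dvd dvd_def)
  have "r \<noteq> 0"
    using r Suc.prems(1) by auto
  moreover have "degree q = Suc (degree r)"
    unfolding r by (subst degree_mult_eq) (use \<open>r \<noteq> 0\<close> in auto)
  moreover have "w \<notin> spectrum A" if "poly r w = 0" for w
    using that Suc.prems(2)[of w] by (simp add: r)
  ultimately have "bounded_below (complex_poly_operator A r)"
    using Suc.hyps by auto
  then obtain c where c: "c > 0" "\<And>x. c * norm x \<le> norm (complex_poly_operator A r x)"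
    by (auto simp: bounded_below_def)
  obtain d where d: "d > 0" "\<And>x. d * norm x \<le> norm (z *\<^sub>C x - A x)"
    using Suc.prems(2)[OF z] by (auto simp: spectrum_iff_not_bounded_below[OF A] bounded_below_def)
  have "d * c * norm x \<le> norm (complex_poly_operator A q x)" for x
  proof -
    have "d * c * norm x \<le> d * norm (complex_poly_operator A r x)"
      using c(2)[of x] d(1) by simp
    also have "\<dots> \<le> norm (complex_poly_operator A q x)"
      unfolding r complex_poly_operator_linear_factor[OF self_adjoint_bounded_operator[OF A]]
      using d(2) by (metis norm_minus_commute)
    finally show ?thesis .
  qed
  then show ?case
    unfolding bounded_below_def using c(1) d(1) by (intro exI[of _ "d * c"]) auto
qed

lemma poly_operator_eq_sum:
  assumes "degree p \<le> N"
  shows "poly_operator E p A x = (\<Sum>i\<le>N. coeff p i *\<^sub>R (A ^^ i) (E x))"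
  unfolding poly_operator_def
  by (rule sum.mono_neutral_left) (use assms in \<open>auto simp: coeff_eq_0\<close>)

lemma poly_operator_add:
  "poly_operator E (p + q) A x = poly_operator E p A x + poly_operator E q A x"
proof -
  define N where "N = max (degree p) (degree q)"
  have "degree (p + q) \<le> N" "degree p \<le> N" "degree q \<le> N"
    by (auto simp: N_def degree_add_le_max)
  then show ?thesis
    by (simp add: poly_operator_eq_sum[of _ N] scaleR_add_left sum.distrib)
qed

lemma poly_operator_smult: "poly_operator E (smult c p) A x = c *\<^sub>R poly_operator E p A x"
  by (subst poly_operator_eq_sum[OF degree_smult_le]) (simp add: poly_operator_def scaleR_sum_right)

lemma poly_operator_diff:
  "poly_operator E (p - q) A x = poly_operator E p A x - poly_operator E q A x"
  using poly_operator_add[of E p "- q" A x] poly_operator_smult[of E "-1" q A x] by simp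

lemma poly_operator_const: "poly_operator id [:c:] A x = c *\<^sub>R x"
  by (simp add: poly_operator_def)

lemma poly_operator_pCons:
  assumes "linear A"
  shows "poly_operator id (pCons c p) A x = c *\<^sub>R x + A (poly_operator id p A x)"
  by (subst poly_operator_eq_sum[OF degree_pCons_le], subst sum.atMost_Suc_shift)
    (simp add: poly_operator_def linear_sum[OF assms] linear_scale[OF assms])

lemma bounded_operator_poly_operator:
  assumes "bounded_operator A" "bounded_operator E"
  shows "bounded_operator (poly_operator E p A)"
proof -
  have "bounded_operator (\<lambda>x. \<Sum>i\<le>degree p. coeff p i *\<^sub>R (A ^^ i) (E x))"
    by (intro bounded_operator_sum bounded_operator_scaleR bounded_operator_compose[of "A ^^ _" E]
        bounded_operator_funpow assms)
  then show ?thesis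
    by (simp add: poly_operator_def[abs_def])
qed

lemma self_adjoint_poly_operator:
  assumes "self_adjoint A"
  shows "self_adjoint (poly_operator id p A)"
proof -
  have "self_adjoint (\<lambda>x. \<Sum>i\<le>degree p. coeff p i *\<^sub>R (A ^^ i) x)"
    by (intro self_adjoint_sum self_adjoint_scaleR self_adjoint_funpow assms)
  then show ?thesis
    by (simp add: poly_operator_def[abs_def])
qed

lemma poly_operator_conv_complex:
  "poly_operator id p A x = complex_poly_operator A (map_poly complex_of_real p) x"
  by (simp add: poly_operator_def complex_poly_operator_def degree_map_poly coeff_map_poly scaleC_of_real)

lemma poly_map_poly_of_real:
  "poly (map_poly complex_of_real p) (complex_of_real t) = complex_of_real (poly p t)"
  by (simp add: poly_altdef degree_map_poly coeff_map_poly)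

text \<open>
  The infimum \<open>m\<close> of the form of \<open>p(A)\<close> is in the spectrum of \<open>p(A)\<close>, so \<open>p(A) - m\<close> is not bounded
  below, and then one of the linear factors of \<open>p - m\<close> has its root in the spectrum of \<open>A\<close>. Thus \<open>m\<close> is
  a value of \<open>p\<close> on the spectrum.
\<close>

lemma poly_operator_nonneg:
  fixes A :: "'a::complex_hilbert_space \<Rightarrow> 'a"
  assumes nz: "\<exists>x::'a. x \<noteq> 0" and A: "self_adjoint A"
    and p: "\<And>t. t \<in> real_spectrum A \<Longrightarrow> 0 \<le> poly p t"
  shows "0 \<le> inner (poly_operator id p A x) x"
proof -
  obtain m where m: "m \<in> real_spectrum (poly_operator id p A)"
      and lower: "\<And>x. m * (norm x)\<^sup>2 \<le> inner (poly_operator id p A x) x"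
    using form_infimum_in_spectrum[OF nz self_adjoint_poly_operator[OF A]] by blast
  have "\<exists>t\<in>real_spectrum A. poly p t = m"
  proof (cases "p = [:m:]")
    case True
    then show ?thesis
      using form_infimum_in_spectrum[OF nz A] by auto
  next
    case False
    define q where "q = map_poly complex_of_real (p - [:m:])"
    have "poly_operator id p A x - m *\<^sub>R x = complex_poly_operator A q x" for x
      unfolding q_def poly_operator_conv_complex[symmetric] poly_operator_diff poly_operator_const ..
    then have "\<not> bounded_below (complex_poly_operator A q)"
      using m real_spectrum_iff[OF self_adjoint_poly_operator[OF A], of m p]
      by (simp add: bounded_below_def)
    moreover have "q \<noteq> 0"
    proof
      assume "q = 0"
      then have "coeff q i = 0" for i by simp
      then have "p - [:m:] = 0"
        by (intro poly_eqI) (simp add: q_def coeff_map_poly)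
      then show False
        using False by simp
    qed
    ultimately obtain z where z: "poly q z = 0" "z \<in> spectrum A"
      using complex_poly_operator_bounded_below[OF A] by blast
    then obtain t where t: "z = complex_of_real t"
      using spectrum_real[OF A] by (auto elim: Reals_cases)
    have "complex_of_real (poly (p - [:m:]) t) = 0"
      using z(1) unfolding q_def t poly_map_poly_of_real .
    then have "poly p t = m"
      unfolding of_real_eq_0_iff by simp
    then show ?thesis
      using z t by auto
  qed
  then have "0 \<le> m"
    using p by auto
  then show ?thesis
    using lower[of x] by (meson order_trans mult_nonneg_nonneg zero_le_power2)
qed

text \<open>This is the previous lemma for \<open>M - p\<close> and \<open>M + p\<close>.\<close>

lemma norm_poly_operator_le:
  fixes A :: "'a::complex_hilbert_space \<Rightarrow> 'a"
  assumes nz: "\<exists>x::'a. x \<noteq> 0" and A: "self_adjoint A" and M: "M > 0"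
    and p: "\<And>t. t \<in> real_spectrum A \<Longrightarrow> \<bar>poly p t\<bar> \<le> M"
  shows "norm (poly_operator id p A x) \<le> M * norm x"
proof (rule norm_le_of_form_le[OF self_adjoint_poly_operator[OF A] M])
  fix x
  have "0 \<le> inner (poly_operator id ([:M:] - p) A x) x"
    by (rule poly_operator_nonneg[OF nz A]) (use p in fastforce)
  moreover have "0 \<le> inner (poly_operator id ([:M:] + p) A x) x"
    by (rule poly_operator_nonneg[OF nz A]) (use p in fastforce)
  ultimately show "\<bar>inner (poly_operator id p A x) x\<bar> \<le> M * (norm x)\<^sup>2"
    unfolding poly_operator_diff poly_operator_add poly_operator_const inner_diff_left inner_add_left
      inner_scaleR_left power2_norm_eq_inner by linarith
qed


section \<open>Continuous functional calculus\<close>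

lemma poly_uniform_approximation:
  fixes g :: "real \<Rightarrow> real"
  assumes "compact S" "continuous_on S g" "e > 0"
  shows "\<exists>p. \<forall>t\<in>S. \<bar>poly p t - g t\<bar> < e"
proof -
  obtain f where f: "real_polynomial_function f" "\<And>t. t \<in> S \<Longrightarrow> \<bar>g t - f t\<bar> < e"
    using Stone_Weierstrass_real_polynomial_function[OF assms] by blast
  then obtain a n where "f = (\<lambda>t. \<Sum>i\<le>n. a i * t ^ i)"
    by (auto simp: real_polynomial_function_iff_sum)
  then have "poly (\<Sum>i\<le>n. monom (a i) i) t = f t" for t
    by (simp add: poly_sum poly_monom)
  then show ?thesis
    using f(2) by (metis abs_minus_commute)
qed

lemma poly_uniform_limit_exists:
  fixes g :: "real \<Rightarrow> real"
  assumes "compact S" "continuous_on S g"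
  shows "\<exists>p. uniform_limit S (\<lambda>n. poly (p n)) g sequentially"
proof -
  have "\<forall>n. \<exists>p. \<forall>t\<in>S. \<bar>poly p t - g t\<bar> < inverse (real (Suc n))"
    by (intro allI poly_uniform_approximation assms) simp
  then obtain p where p: "\<And>n t. t \<in> S \<Longrightarrow> \<bar>poly (p n) t - g t\<bar> < inverse (real (Suc n))"
    by metis
  have "uniform_limit S (\<lambda>n. poly (p n)) g sequentially"
  proof (rule uniform_limitI)
    fix e :: real assume "e > 0"
    then obtain N where N: "inverse (real (Suc N)) < e"
      using reals_Archimedean by blast
    have "dist (poly (p n) t) (g t) < e" if "n \<ge> N" "t \<in> S" for n t
    proof -
      have "inverse (real (Suc n)) \<le> inverse (real (Suc N))"
        using that by (intro le_imp_inverse_le) auto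
      then show ?thesis
        using p[OF that(2), of n] N unfolding dist_real_def by linarith
    qed
    then show "\<forall>\<^sub>F n in sequentially. \<forall>t\<in>S. dist (poly (p n) t) (g t) < e"
      unfolding eventually_sequentially by blast
  qed
  then show ?thesis by blast
qed

text \<open>
  By the norm bound, polynomials of \<open>A\<close> converge pointwise along one approximating sequence; comparing
  with this sequence shows that the limit does not depend on it and is attained in norm.
\<close>

lemma functional_calculus_exists:
  fixes A :: "'a::complex_hilbert_space \<Rightarrow> 'a"
  assumes nz: "\<exists>x::'a. x \<noteq> 0" and A: "self_adjoint A" and g: "continuous_on (real_spectrum A) g"
  shows "\<exists>T. self_adjoint T \<and> (\<forall>p. uniform_limit (real_spectrum A) (\<lambda>n. poly (p n)) g sequentially \<longrightarrow>
    (\<lambda>n. onorm (\<lambda>x. poly_operator id (p n) A x - T x)) \<longlonglongrightarrow> 0)"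
proof -
  let ?S = "real_spectrum A"
  obtain q where q: "uniform_limit ?S (\<lambda>n. poly (q n)) g sequentially"
    using poly_uniform_limit_exists[OF compact_real_spectrum[OF nz A] g] by blast
  have close: "norm (poly_operator id p A x - poly_operator id r A x) \<le> (d + e) * norm x"
    if "\<And>t. t \<in> ?S \<Longrightarrow> dist (poly p t) (g t) < d" "\<And>t. t \<in> ?S \<Longrightarrow> dist (poly r t) (g t) < e"
      "d > 0" "e > 0" for p r d e x
    unfolding poly_operator_diff[symmetric]
  proof (rule norm_poly_operator_le[OF nz A])
    show "\<bar>poly (p - r) t\<bar> \<le> d + e" if "t \<in> ?S" for t
      using \<open>\<And>t. t \<in> ?S \<Longrightarrow> dist (poly p t) (g t) < d\<close>[OF that]
        \<open>\<And>t. t \<in> ?S \<Longrightarrow> dist (poly r t) (g t) < e\<close>[OF that]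
      by (simp add: dist_real_def)
  qed (use that in auto)
  have q_close: "\<exists>N. \<forall>n\<ge>N. \<forall>t\<in>?S. dist (poly (q n) t) (g t) < e" if "e > 0" for e
    using q that by (simp add: uniform_limit_sequentially_iff)
  have "Cauchy (\<lambda>n. poly_operator id (q n) A x)" for x
  proof (rule metric_CauchyI)
    fix e :: real assume e: "e > 0"
    define d where "d = e / (2 * norm x + 1) / 2"
    have d: "d > 0" "(d + d) * norm x < e"
      using e by (auto simp: d_def field_simps add_pos_nonneg)
    obtain N where N: "\<forall>n\<ge>N. \<forall>t\<in>?S. dist (poly (q n) t) (g t) < d"
      using q_close[OF d(1)] by blast
    have "dist (poly_operator id (q m) A x) (poly_operator id (q n) A x) < e" if "m \<ge> N" "n \<ge> N" for m n
    proof -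
      have "norm (poly_operator id (q m) A x - poly_operator id (q n) A x) \<le> (d + d) * norm x"
        by (rule close) (use N that d in auto)
      then show ?thesis
        using d(2) by (simp add: dist_norm)
    qed
    then show "\<exists>M. \<forall>m\<ge>M. \<forall>n\<ge>M. dist (poly_operator id (q m) A x) (poly_operator id (q n) A x) < e"
      by blast
  qed
  then have "\<forall>x. \<exists>y. (\<lambda>n. poly_operator id (q n) A x) \<longlonglongrightarrow> y"
    by (simp add: Cauchy_convergent_iff convergent_def)
  then obtain T where T: "\<And>x. (\<lambda>n. poly_operator id (q n) A x) \<longlonglongrightarrow> T x"
    by metis
  have error: "norm (poly_operator id p A x - T x) \<le> d * norm x"
    if p: "\<And>t. t \<in> ?S \<Longrightarrow> dist (poly p t) (g t) < d" and d: "d > 0" for p d x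
  proof (rule field_le_epsilon)
    fix e :: real assume e: "e > 0"
    define r where "r = e / (norm x + 1)"
    have r: "r > 0" "r * norm x \<le> e"
      using e by (auto simp: r_def field_simps add_pos_nonneg)
    obtain N where N: "\<forall>n\<ge>N. \<forall>t\<in>?S. dist (poly (q n) t) (g t) < r"
      using q_close[OF r(1)] by blast
    have "norm (poly_operator id p A x - T x) \<le> (d + r) * norm x"
    proof (rule tendsto_upperbound)
      show "(\<lambda>n. norm (poly_operator id p A x - poly_operator id (q n) A x))
          \<longlonglongrightarrow> norm (poly_operator id p A x - T x)"
        by (intro tendsto_intros T)
      have "norm (poly_operator id p A x - poly_operator id (q n) A x) \<le> (d + r) * norm x"
        if "n \<ge> N" for n
        by (rule close[OF p _ d r(1)]) (use N that in auto)
      then show "\<forall>\<^sub>F n in sequentially.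
          norm (poly_operator id p A x - poly_operator id (q n) A x) \<le> (d + r) * norm x"
        unfolding eventually_sequentially by blast
    qed simp
    then show "norm (poly_operator id p A x - T x) \<le> d * norm x + e"
      using r(2) by (simp add: distrib_right)
  qed
  have lin: "bounded_linear (poly_operator id p A)" for p
    by (rule self_adjoint_bounded_linear[OF self_adjoint_poly_operator[OF A]])
  have "bounded_linear T"
  proof -
    obtain N where N: "\<forall>n\<ge>N. \<forall>t\<in>?S. dist (poly (q n) t) (g t) < 1"
      using q_close[of 1] by auto
    obtain K where K: "\<And>x. norm (poly_operator id (q N) A x) \<le> norm x * K"
      using bounded_linear.bounded[OF lin[of "q N"]] by blast
    show ?thesis
    proof (rule bounded_linear_intro[of _ "K + 1"])
      fix x y :: 'a and c :: real
      have "(\<lambda>n. poly_operator id (q n) A (x + y)) \<longlonglongrightarrow> T x + T y"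
        unfolding linear_add[OF bounded_linear.linear[OF lin]] by (intro tendsto_intros T)
      then show "T (x + y) = T x + T y"
        using T LIMSEQ_unique by blast
      have "(\<lambda>n. poly_operator id (q n) A (c *\<^sub>R x)) \<longlonglongrightarrow> c *\<^sub>R T x"
        unfolding linear_scale[OF bounded_linear.linear[OF lin]] by (intro tendsto_intros T)
      then show "T (c *\<^sub>R x) = c *\<^sub>R T x"
        using T LIMSEQ_unique by blast
      have "norm (poly_operator id (q N) A x - T x) \<le> 1 * norm x"
        by (rule error) (use N in auto)
      then show "norm (T x) \<le> norm x * (K + 1)"
        using K[of x] norm_triangle_ineq2[of "T x" "poly_operator id (q N) A x"]
        by (simp add: algebra_simps norm_minus_commute)
    qed
  qed
  moreover have "T (c *\<^sub>C x) = c *\<^sub>C T x" for c x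
  proof -
    have "(\<lambda>n. poly_operator id (q n) A (c *\<^sub>C x)) \<longlonglongrightarrow> c *\<^sub>C T x"
      unfolding bounded_operator_scaleC[OF self_adjoint_bounded_operator[OF self_adjoint_poly_operator[OF A]]]
      by (intro bounded_linear.tendsto[OF bounded_linear_scaleC] T)
    then show ?thesis
      using T LIMSEQ_unique by blast
  qed
  moreover have "inner (T x) y = inner x (T y)" for x y
  proof (rule LIMSEQ_unique)
    show "(\<lambda>n. inner (poly_operator id (q n) A x) y) \<longlonglongrightarrow> inner (T x) y"
      by (intro tendsto_intros T)
    show "(\<lambda>n. inner (poly_operator id (q n) A x) y) \<longlonglongrightarrow> inner x (T y)"
      unfolding self_adjoint_inner[OF self_adjoint_poly_operator[OF A]] by (intro tendsto_intros T)
  qed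
  ultimately have "self_adjoint T"
    by (simp add: self_adjoint_iff_inner bounded_operator_def)
  moreover have "(\<lambda>n. onorm (\<lambda>x. poly_operator id (p n) A x - T x)) \<longlonglongrightarrow> 0"
    if p: "uniform_limit ?S (\<lambda>n. poly (p n)) g sequentially" for p
  proof (rule LIMSEQ_I)
    fix e :: real assume "e > 0"
    then obtain N where N: "\<forall>n\<ge>N. \<forall>t\<in>?S. dist (poly (p n) t) (g t) < e / 2"
      using p by (metis half_gt_zero uniform_limit_sequentially_iff)
    have "norm (onorm (\<lambda>x. poly_operator id (p n) A x - T x) - 0) < e" if n: "n \<ge> N" for n
    proof -
      have "bounded_linear (\<lambda>x. poly_operator id (p n) A x - T x)"
        by (intro bounded_linear_sub lin \<open>bounded_linear T\<close>)
      then have "0 \<le> onorm (\<lambda>x. poly_operator id (p n) A x - T x)"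
        by (rule onorm_pos_le)
      moreover have "onorm (\<lambda>x. poly_operator id (p n) A x - T x) \<le> e / 2"
      proof (rule onorm_bound)
        show "norm (poly_operator id (p n) A x - T x) \<le> e / 2 * norm x" for x
          by (rule error) (use N n \<open>e > 0\<close> in auto)
      qed (use \<open>e > 0\<close> in simp)
      ultimately show ?thesis
        using \<open>e > 0\<close> by simp
    qed
    then show "\<exists>N. \<forall>n\<ge>N. norm (onorm (\<lambda>x. poly_operator id (p n) A x - T x) - 0) < e"
      by blast
  qed
  ultimately show ?thesis
    by blast
qed

lemma tendsto_of_onorm_tendsto_zero:
  fixes T :: "'a::real_normed_vector \<Rightarrow> 'b::real_normed_vector"
  assumes "\<And>n. bounded_linear (f n)" "bounded_linear T" "(\<lambda>n. onorm (\<lambda>x. f n x - T x)) \<longlonglongrightarrow> 0"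
  shows "(\<lambda>n. f n x) \<longlonglongrightarrow> T x"
proof -
  have "norm (f n x - T x) \<le> onorm (\<lambda>x. f n x - T x) * norm x" for n
    by (rule onorm[OF bounded_linear_sub[OF assms(1,2)]])
  moreover have "(\<lambda>n. onorm (\<lambda>x. f n x - T x) * norm x) \<longlonglongrightarrow> 0"
    using tendsto_mult_left_zero[OF assms(3)] .
  ultimately have "(\<lambda>n. f n x - T x) \<longlonglongrightarrow> 0"
    by (intro Lim_null_comparison[of "\<lambda>n. f n x - T x"]) auto
  then show ?thesis
    by (rule LIM_zero_cancel)
qed

text \<open>
  One approximating sequence suffices for uniqueness of the limit, which makes the definite description
  in the definition of the functional calculus well-defined.
\<close>

lemma functional_calculus_on_eqI:
  assumes E: "bounded_operator E" and A: "bounded_operator A" and T: "operator_on E T"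
    and q: "uniform_limit {t. complex_of_real t \<in> spectrum_on E A} (\<lambda>n. poly (q n)) g sequentially"
    and lim: "\<And>p. uniform_limit {t. complex_of_real t \<in> spectrum_on E A} (\<lambda>n. poly (p n)) g sequentially
      \<Longrightarrow> (\<lambda>n. onorm (\<lambda>x. poly_operator E (p n) A x - T x)) \<longlonglongrightarrow> 0"
  shows "functional_calculus_on E g A = T"
  unfolding functional_calculus_on_def
proof (rule the_equality)
  show "operator_on E T \<and> (\<forall>p. uniform_limit {t. complex_of_real t \<in> spectrum_on E A} (\<lambda>n. poly (p n)) g
      sequentially \<longrightarrow> (\<lambda>n. onorm (\<lambda>x. poly_operator E (p n) A x - T x)) \<longlonglongrightarrow> 0)"
    using T lim by blast
next
  fix S
  assume S: "operator_on E S \<and> (\<forall>p. uniform_limit {t. complex_of_real t \<in> spectrum_on E A}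
      (\<lambda>n. poly (p n)) g sequentially \<longrightarrow> (\<lambda>n. onorm (\<lambda>x. poly_operator E (p n) A x - S x)) \<longlonglongrightarrow> 0)"
  have lin: "bounded_linear (poly_operator E p A)" for p
    by (intro bounded_operator_bounded_linear bounded_operator_poly_operator E A)
  have bl: "bounded_linear S" "bounded_linear T"
    using S T by (auto simp: operator_on_def bounded_operator_def)
  have limS: "(\<lambda>n. onorm (\<lambda>x. poly_operator E (q n) A x - S x)) \<longlonglongrightarrow> 0"
    using S q by blast
  have "S x = T x" for x
    using tendsto_of_onorm_tendsto_zero[OF lin bl(1) limS, of x]
      tendsto_of_onorm_tendsto_zero[OF lin bl(2) lim[OF q], of x] LIMSEQ_unique by blast
  then show "S = T"
    by blast
qed

lemma functional_calculus_props:
  fixes A :: "'a::complex_hilbert_space \<Rightarrow> 'a"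
  assumes nz: "\<exists>x::'a. x \<noteq> 0" and A: "self_adjoint A" and g: "continuous_on (real_spectrum A) g"
  shows self_adjoint_functional_calculus: "self_adjoint (functional_calculus g A)"
    and functional_calculus_onorm_tendsto:
      "uniform_limit (real_spectrum A) (\<lambda>n. poly (p n)) g sequentially \<Longrightarrow>
        (\<lambda>n. onorm (\<lambda>x. poly_operator id (p n) A x - functional_calculus g A x)) \<longlonglongrightarrow> 0"
    and functional_calculus_tendsto:
      "uniform_limit (real_spectrum A) (\<lambda>n. poly (p n)) g sequentially \<Longrightarrow>
        (\<lambda>n. poly_operator id (p n) A x) \<longlonglongrightarrow> functional_calculus g A x"
proof -
  obtain T where T: "self_adjoint T"
    and lim: "\<And>p. uniform_limit (real_spectrum A) (\<lambda>n. poly (p n)) g sequentially \<Longrightarrow>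
      (\<lambda>n. onorm (\<lambda>x. poly_operator id (p n) A x - T x)) \<longlonglongrightarrow> 0"
    using functional_calculus_exists[OF assms] by blast
  obtain q where q: "uniform_limit (real_spectrum A) (\<lambda>n. poly (q n)) g sequentially"
    using poly_uniform_limit_exists[OF compact_real_spectrum[OF nz A] g] by blast
  have eq: "functional_calculus g A = T"
    by (rule functional_calculus_on_eqI[OF bounded_operator_id(1) _ _ q lim])
      (auto simp: operator_on_id T A self_adjoint_bounded_operator)
  show "self_adjoint (functional_calculus g A)"
    using T eq by simp
  show *: "uniform_limit (real_spectrum A) (\<lambda>n. poly (p n)) g sequentially \<Longrightarrow>
        (\<lambda>n. onorm (\<lambda>x. poly_operator id (p n) A x - functional_calculus g A x)) \<longlonglongrightarrow> 0"
    using lim eq by simp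
  show "(\<lambda>n. poly_operator id (p n) A x) \<longlonglongrightarrow> functional_calculus g A x"
    if p: "uniform_limit (real_spectrum A) (\<lambda>n. poly (p n)) g sequentially"
    unfolding eq
    by (rule tendsto_of_onorm_tendsto_zero[OF self_adjoint_bounded_linear[OF self_adjoint_poly_operator[OF A]]
          self_adjoint_bounded_linear[OF T] lim[OF p]])
qed

lemma functional_calculus_eigenvector:
  fixes A :: "'a::complex_hilbert_space \<Rightarrow> 'a"
  assumes A: "self_adjoint A" and g: "continuous_on (real_spectrum A) g"
    and x: "x \<noteq> 0" "A x = t *\<^sub>R x"
  shows "functional_calculus g A x = g t *\<^sub>R x"
proof -
  have nz: "\<exists>x::'a. x \<noteq> 0" using x by blast
  have lin: "linear A"
    by (rule bounded_linear.linear[OF self_adjoint_bounded_linear[OF A]])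
  have t: "t \<in> real_spectrum A"
    unfolding real_spectrum_iff[OF A] bounded_below_def
    using x by (auto simp: mult_le_0_iff intro!: exI[of _ x])
  have "poly_operator id p A x = poly p t *\<^sub>R x" for p
  proof (induction p)
    case 0
    show ?case by (simp add: poly_operator_def)
  next
    case (pCons a p)
    show ?case
      unfolding poly_operator_pCons[OF lin] pCons.IH linear_scale[OF lin] x(2)
      by (simp add: scaleR_add_left mult.commute)
  qed
  moreover obtain p where p: "uniform_limit (real_spectrum A) (\<lambda>n. poly (p n)) g sequentially"
    using poly_uniform_limit_exists[OF compact_real_spectrum[OF nz A] g] by blast
  ultimately have "(\<lambda>n. poly (p n) t *\<^sub>R x) \<longlonglongrightarrow> functional_calculus g A x"
    using functional_calculus_tendsto[OF nz A g p, of x] by simp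
  moreover have "(\<lambda>n. poly (p n) t *\<^sub>R x) \<longlonglongrightarrow> g t *\<^sub>R x"
    by (intro tendsto_intros tendsto_uniform_limitI[OF p t])
  ultimately show ?thesis
    by (rule LIMSEQ_unique)
qed

text \<open>
  The calculus commutes with translations. This turns \<open>g(A - d)\<close> into a function of \<open>A\<close> itself, so
  that it can be compared with \<open>g(A)\<close> on the spectrum of \<open>A\<close>.
\<close>

lemma real_spectrum_shift:
  assumes A: "self_adjoint A"
  shows "s \<in> real_spectrum (\<lambda>x. A x - d *\<^sub>R x) \<longleftrightarrow> s + d \<in> real_spectrum A"
proof -
  have "A x - d *\<^sub>R x - s *\<^sub>R x = A x - (s + d) *\<^sub>R x" for x
    by (simp add: scaleR_add_left)
  then show ?thesis
    unfolding real_spectrum_iff[OF A] real_spectrum_iff[OF self_adjoint_diff_scaleR[OF A]] by presburger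
qed

lemma poly_operator_shift:
  assumes "linear A"
  shows "poly_operator id p (\<lambda>x. A x - d *\<^sub>R x) x = poly_operator id (pcompose p [:- d, 1:]) A x"
proof (induction p)
  case 0
  show ?case by (simp add: poly_operator_def)
next
  case (pCons a p)
  have lin: "linear (\<lambda>x. A x - d *\<^sub>R x)"
    by (intro linear_compose_sub assms linear_scaleR)
  have "pcompose (pCons a p) [:- d, 1:] =
      [:a:] + (smult (- d) (pcompose p [:- d, 1:]) + pCons 0 (pcompose p [:- d, 1:]))"
    by (simp add: pcompose_pCons)
  moreover have "poly_operator id 0 A x = 0"
    by (simp add: poly_operator_def)
  ultimately show ?case
    unfolding poly_operator_pCons[OF lin] pCons.IH
    by (simp only: poly_operator_add poly_operator_smult poly_operator_pCons[OF assms] linear_0[OF assms]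
        scaleR_minus_left) simp
qed

lemma functional_calculus_shift:
  fixes A :: "'a::complex_hilbert_space \<Rightarrow> 'a"
  assumes nz: "\<exists>x::'a. x \<noteq> 0" and A: "self_adjoint A"
    and g: "continuous_on (real_spectrum (\<lambda>x. A x - d *\<^sub>R x)) g"
  shows "functional_calculus g (\<lambda>x. A x - d *\<^sub>R x) x = functional_calculus (\<lambda>t. g (t - d)) A x"
proof -
  let ?A = "\<lambda>x. A x - d *\<^sub>R x"
  have lin: "linear A"
    by (rule bounded_linear.linear[OF self_adjoint_bounded_linear[OF A]])
  note Ad = self_adjoint_diff_scaleR[OF A, of d]
  have shift: "t - d \<in> real_spectrum ?A" if "t \<in> real_spectrum A" for t
    using that real_spectrum_shift[OF A, of "t - d" d] by simp
  obtain p where p: "uniform_limit (real_spectrum ?A) (\<lambda>n. poly (p n)) g sequentially"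
    using poly_uniform_limit_exists[OF compact_real_spectrum[OF nz Ad] g] by blast
  have "uniform_limit (real_spectrum A) (\<lambda>n t. poly (p n) (t - d)) (\<lambda>t. g (t - d)) sequentially"
    using shift by (intro uniform_limit_compose'[OF p]) auto
  moreover have "(\<lambda>n t. poly (p n) (t - d)) = (\<lambda>n. poly (pcompose (p n) [:- d, 1:]))"
    by (simp add: poly_pcompose fun_eq_iff)
  ultimately have "uniform_limit (real_spectrum A) (\<lambda>n. poly (pcompose (p n) [:- d, 1:])) (\<lambda>t. g (t - d)) sequentially"
    by simp
  moreover have "continuous_on (real_spectrum A) (\<lambda>t. g (t - d))"
    by (rule continuous_on_compose2[OF g]) (use shift in \<open>auto intro!: continuous_intros\<close>)
  ultimately have "(\<lambda>n. poly_operator id (p n) ?A x) \<longlonglongrightarrow> functional_calculus (\<lambda>t. g (t - d)) A x"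
    unfolding poly_operator_shift[OF lin] by (intro functional_calculus_tendsto[OF nz A])
  moreover have "(\<lambda>n. poly_operator id (p n) ?A x) \<longlonglongrightarrow> functional_calculus g ?A x"
    by (rule functional_calculus_tendsto[OF nz Ad g p])
  ultimately show ?thesis
    by (rule LIMSEQ_unique[symmetric])
qed

text \<open>
  For polynomials \<open>p\<close> and \<open>q\<close> close to \<open>g\<close> and \<open>h\<close>, the polynomial \<open>p - q - k\<close> is nonnegative on the
  spectrum up to a small error, and positivity of polynomials of \<open>A\<close> applies.
\<close>

lemma functional_calculus_form_diff_ge:
  fixes A :: "'a::complex_hilbert_space \<Rightarrow> 'a"
  assumes nz: "\<exists>x::'a. x \<noteq> 0" and A: "self_adjoint A"
    and g: "continuous_on (real_spectrum A) g" and h: "continuous_on (real_spectrum A) h"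
    and k: "\<And>t. t \<in> real_spectrum A \<Longrightarrow> k \<le> g t - h t"
  shows "k * (norm x)\<^sup>2 \<le> inner (functional_calculus g A x) x - inner (functional_calculus h A x) x"
proof -
  let ?S = "real_spectrum A"
  obtain p where p: "uniform_limit ?S (\<lambda>n. poly (p n)) g sequentially"
    using poly_uniform_limit_exists[OF compact_real_spectrum[OF nz A] g] by blast
  obtain q where q: "uniform_limit ?S (\<lambda>n. poly (q n)) h sequentially"
    using poly_uniform_limit_exists[OF compact_real_spectrum[OF nz A] h] by blast
  have lim: "(\<lambda>n. inner (poly_operator id (p n) A x) x - inner (poly_operator id (q n) A x) x)
      \<longlonglongrightarrow> inner (functional_calculus g A x) x - inner (functional_calculus h A x) x"
    by (intro tendsto_intros functional_calculus_tendsto nz A g h p q)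
  have bound: "k * (norm x)\<^sup>2 - e * (norm x)\<^sup>2 \<le>
      inner (functional_calculus g A x) x - inner (functional_calculus h A x) x" if e: "e > 0" for e
  proof (rule tendsto_lowerbound[OF lim])
    have "\<forall>\<^sub>F n in sequentially. \<forall>t\<in>?S. dist (poly (p n) t) (g t) < e / 2"
         "\<forall>\<^sub>F n in sequentially. \<forall>t\<in>?S. dist (poly (q n) t) (h t) < e / 2"
      using uniform_limitD[OF p, of "e / 2"] uniform_limitD[OF q, of "e / 2"] e by simp_all
    then show "\<forall>\<^sub>F n in sequentially. k * (norm x)\<^sup>2 - e * (norm x)\<^sup>2 \<le>
        inner (poly_operator id (p n) A x) x - inner (poly_operator id (q n) A x) x"
    proof eventually_elim
      case (elim n)
      have "0 \<le> inner (poly_operator id (p n - q n - [:k - e:]) A x) x"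
      proof (rule poly_operator_nonneg[OF nz A])
        fix t assume t: "t \<in> ?S"
        have "\<bar>poly (p n) t - g t\<bar> < e / 2" "\<bar>poly (q n) t - h t\<bar> < e / 2"
          using elim t by (auto simp: dist_real_def)
        moreover have "poly (p n - q n - [:k - e:]) t = poly (p n) t - poly (q n) t - (k - e)"
          by simp
        ultimately show "0 \<le> poly (p n - q n - [:k - e:]) t"
          using k[OF t] by linarith
      qed
      then show ?case
        by (simp add: poly_operator_diff poly_operator_const inner_diff_left power2_norm_eq_inner
            left_diff_distrib)
    qed
  qed simp
  show ?thesis
  proof (cases "x = 0")
    case True
    interpret G: bounded_linear "functional_calculus g A"
      by (rule self_adjoint_bounded_linear[OF self_adjoint_functional_calculus[OF nz A g]])
    show ?thesis
      using True by simp
  next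
    case False
    show ?thesis
    proof (rule field_le_epsilon)
      fix e :: real assume "e > 0"
      then have "e / (norm x)\<^sup>2 > 0" using False by simp
      from bound[OF this] show "k * (norm x)\<^sup>2 \<le>
          inner (functional_calculus g A x) x - inner (functional_calculus h A x) x + e"
        using False by simp
    qed
  qed
qed

section \<open>Isometric embeddings and direct sums\<close>

text \<open>
  An isometry \<open>V\<close> together with its adjoint \<open>W\<close>. Operators are moved along \<open>V\<close> in both directions:
  \<open>V A W\<close> is a copy of \<open>A\<close> on the range of the projection \<open>V W\<close>, and \<open>W X V\<close> is a compression of \<open>X\<close>.
\<close>

locale isometric_embedding =
  fixes V :: "'a::complex_hilbert_space \<Rightarrow> 'b::complex_hilbert_space" and W :: "'b \<Rightarrow> 'a"
  assumes bounded_linear_V: "bounded_linear V" and V_scaleC: "V (c *\<^sub>C x) = c *\<^sub>C V x"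
    and bounded_linear_W: "bounded_linear W" and W_scaleC: "W (c *\<^sub>C y) = c *\<^sub>C W y"
    and W_V: "W (V x) = x" and adjoint: "inner (V x) y = inner x (W y)"
begin

lemma norm_V: "norm (V x) = norm x"
  by (simp add: norm_eq_sqrt_inner adjoint W_V)

lemma norm_W: "norm (W y) \<le> norm y"
proof (cases "W y = 0")
  case False
  have "norm (W y) * norm (W y) = inner (V (W y)) y"
    by (simp add: adjoint power2_norm_eq_inner[symmetric] power2_eq_square)
  also have "\<dots> \<le> norm (W y) * norm y"
    using norm_cauchy_schwarz[of "V (W y)" y] by (simp add: norm_V)
  finally show ?thesis
    using False by simp
qed simp

lemma bounded_operator_copy:
  assumes "bounded_operator A"
  shows "bounded_operator (\<lambda>y. V (A (W y)))"
  unfolding bounded_operator_def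
proof (intro conjI allI)
  show "bounded_linear (\<lambda>y. V (A (W y)))"
    by (rule bounded_linear_compose[OF bounded_linear_V bounded_linear_compose[OF
            bounded_operator_bounded_linear[OF assms] bounded_linear_W]])
qed (simp add: V_scaleC W_scaleC bounded_operator_scaleC[OF assms])

lemma bounded_operator_compression:
  assumes "bounded_operator X"
  shows "bounded_operator (\<lambda>x. W (X (V x)))"
  unfolding bounded_operator_def
proof (intro conjI allI)
  show "bounded_linear (\<lambda>x. W (X (V x)))"
    by (rule bounded_linear_compose[OF bounded_linear_W bounded_linear_compose[OF
            bounded_operator_bounded_linear[OF assms] bounded_linear_V]])
qed (simp add: V_scaleC W_scaleC bounded_operator_scaleC[OF assms])

lemma bounded_operator_range_projection: "bounded_operator (\<lambda>y. V (W y))"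
  using bounded_operator_copy[OF bounded_operator_id(2)] .

lemma operator_on_copy:
  "bounded_operator A \<Longrightarrow> operator_on (\<lambda>y. V (W y)) (\<lambda>y. V (A (W y)))"
  by (simp add: operator_on_def bounded_operator_copy fun_eq_iff W_V)

lemma adjoint': "inner y (V x) = inner (W y) x"
  by (metis adjoint inner_commute)

lemma self_adjoint_copy:
  assumes "self_adjoint A"
  shows "self_adjoint (\<lambda>y. V (A (W y)))"
  unfolding self_adjoint_iff_inner adjoint adjoint' self_adjoint_inner[OF assms]
  using bounded_operator_copy[OF self_adjoint_bounded_operator[OF assms]] by simp

lemma self_adjoint_compression:
  assumes "self_adjoint X"
  shows "self_adjoint (\<lambda>x. W (X (V x)))"
  unfolding self_adjoint_iff_inner adjoint[symmetric] adjoint'[symmetric] self_adjoint_inner[OF assms]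
  using bounded_operator_compression[OF self_adjoint_bounded_operator[OF assms]] by simp

lemma orthogonal_projection_range: "orthogonal_projection (\<lambda>y. V (W y))"
  using self_adjoint_copy[OF self_adjoint_id(2)]
  by (simp add: orthogonal_projection_def fun_eq_iff W_V)

lemma spectrum_on_copy:
  assumes A: "bounded_operator A"
  shows "spectrum_on (\<lambda>y. V (W y)) (\<lambda>y. V (A (W y))) = spectrum A"
proof -
  have diff: "z *\<^sub>C V (W y) - V (A (W y)) = V (z *\<^sub>C W y - A (W y))" for z y
    using linear_diff[OF bounded_linear.linear[OF bounded_linear_V]] by (simp add: V_scaleC)
  have "invertible_on (\<lambda>y. V (W y)) (\<lambda>y. z *\<^sub>C V (W y) - V (A (W y))) \<longleftrightarrow>
      invertible_on id (\<lambda>x. z *\<^sub>C id x - A x)" for z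
  proof
    assume "invertible_on (\<lambda>y. V (W y)) (\<lambda>y. z *\<^sub>C V (W y) - V (A (W y)))"
    then obtain T where T: "bounded_operator T"
        "\<And>y. V (z *\<^sub>C W (T y) - A (W (T y))) = V (W y)" "\<And>y. T (V (z *\<^sub>C W y - A (W y))) = V (W y)"
      by (auto simp: invertible_on_def operator_on_def fun_eq_iff diff)
    have "z *\<^sub>C W (T (V x)) - A (W (T (V x))) = x" for x
      using T(2)[of "V x"] by (metis W_V)
    moreover have "W (T (V (z *\<^sub>C x - A x))) = x" for x
      using T(3)[of "V x"] by (simp add: W_V)
    ultimately show "invertible_on id (\<lambda>x. z *\<^sub>C id x - A x)"
      unfolding invertible_on_id using bounded_operator_compression[OF T(1)]
      by (intro exI[of _ "\<lambda>x. W (T (V x))"]) simp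
  next
    assume "invertible_on id (\<lambda>x. z *\<^sub>C id x - A x)"
    then obtain S where S: "bounded_operator S"
        "\<And>x. z *\<^sub>C S x - A (S x) = x" "\<And>x. S (z *\<^sub>C x - A x) = x"
      by (auto simp: invertible_on_id)
    then show "invertible_on (\<lambda>y. V (W y)) (\<lambda>y. z *\<^sub>C V (W y) - V (A (W y)))"
      unfolding invertible_on_def
      by (intro exI[of _ "\<lambda>y. V (S (W y))"]) (simp add: operator_on_copy fun_eq_iff diff W_V)
  qed
  then show ?thesis
    by (simp add: spectrum_on_def)
qed

lemma poly_operator_copy:
  "poly_operator (\<lambda>y. V (W y)) p (\<lambda>y. V (A (W y))) y = V (poly_operator id p A (W y))"
proof -
  have "((\<lambda>y. V (A (W y))) ^^ i) (V x) = V ((A ^^ i) x)" for i x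
    by (induction i) (simp_all add: W_V)
  then show ?thesis
    by (simp add: poly_operator_def linear_sum[OF bounded_linear.linear[OF bounded_linear_V]]
        linear_scale[OF bounded_linear.linear[OF bounded_linear_V]])
qed

text \<open>
  The functional calculus relative to the range of \<open>V W\<close> is a copy of the absolute one, so no separate
  spectral theory of operators on subspaces has to be developed.
\<close>

lemma functional_calculus_on_copy:
  assumes nz: "\<exists>x::'a. x \<noteq> 0" and A: "self_adjoint A" and g: "continuous_on (real_spectrum A) g"
  shows "functional_calculus_on (\<lambda>y. V (W y)) g (\<lambda>y. V (A (W y))) = (\<lambda>y. V (functional_calculus g A (W y)))"
proof -
  let ?T = "functional_calculus g A"
  note bA = self_adjoint_bounded_operator[OF A]
  note fc = functional_calculus_props[OF assms]
  have S: "{t. complex_of_real t \<in> spectrum_on (\<lambda>y. V (W y)) (\<lambda>y. V (A (W y)))} = real_spectrum A"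
    by (simp add: spectrum_on_copy[OF bA])
  obtain q where q: "uniform_limit (real_spectrum A) (\<lambda>n. poly (q n)) g sequentially"
    using poly_uniform_limit_exists[OF compact_real_spectrum[OF nz A] g] by blast
  show ?thesis
  proof (rule functional_calculus_on_eqI[where q = q], unfold S)
    show "bounded_operator (\<lambda>y. V (W y))" "bounded_operator (\<lambda>y. V (A (W y)))"
      "operator_on (\<lambda>y. V (W y)) (\<lambda>y. V (?T (W y)))"
      using bA fc(1)
      by (auto intro: bounded_operator_range_projection bounded_operator_copy operator_on_copy
          self_adjoint_bounded_operator)
    show "uniform_limit (real_spectrum A) (\<lambda>n. poly (q n)) g sequentially"
      by (rule q)
  next
    fix p assume p: "uniform_limit (real_spectrum A) (\<lambda>n. poly (p n)) g sequentially"
    let ?D = "\<lambda>n x. poly_operator id (p n) A x - ?T x"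
    have D: "bounded_linear (?D n)" for n
      by (intro bounded_linear_sub self_adjoint_bounded_linear self_adjoint_poly_operator A fc(1))
    have eq: "poly_operator (\<lambda>y. V (W y)) (p n) (\<lambda>y. V (A (W y))) y - V (?T (W y)) = V (?D n (W y))" for n y
      unfolding poly_operator_copy
      using linear_diff[OF bounded_linear.linear[OF bounded_linear_V]] by simp
    have bl: "bounded_linear (\<lambda>y. V (?D n (W y)))" for n
      by (rule bounded_linear_compose[OF bounded_linear_V bounded_linear_compose[OF D bounded_linear_W]])
    have "onorm (\<lambda>y. V (?D n (W y))) \<le> onorm (?D n)" for n
    proof (rule onorm_bound[OF onorm_pos_le[OF D]])
      show "norm (V (?D n (W y))) \<le> onorm (?D n) * norm y" for y
        unfolding norm_V
        by (rule order_trans[OF onorm[OF D] mult_left_mono[OF norm_W onorm_pos_le[OF D]]])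
    qed
    then show "(\<lambda>n. onorm (\<lambda>y. poly_operator (\<lambda>y. V (W y)) (p n) (\<lambda>y. V (A (W y))) y - V (?T (W y)))) \<longlonglongrightarrow> 0"
      unfolding eq
      by (intro tendsto_sandwich[OF _ _ tendsto_const fc(2)[OF p]] always_eventually allI onorm_pos_le[OF bl])
  qed
qed

end

lemma isometric_embedding_compose:
  assumes "isometric_embedding U U'" "isometric_embedding V V'"
  shows "isometric_embedding (\<lambda>x. U (V x)) (\<lambda>y. V' (U' y))"
proof -
  interpret U: isometric_embedding U U' by (rule assms)
  interpret V: isometric_embedding V V' by (rule assms)
  show ?thesis
    by (rule isometric_embedding.intro)
      (simp_all add: U.adjoint V.adjoint U.W_V V.W_V U.V_scaleC V.V_scaleC U.W_scaleC V.W_scaleC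
        bounded_linear_compose[OF U.bounded_linear_V V.bounded_linear_V]
        bounded_linear_compose[OF V.bounded_linear_W U.bounded_linear_W])
qed

instantiation prod :: (complex_hilbert_space, complex_hilbert_space) complex_hilbert_space
begin

definition "scaleC_prod c z = (c *\<^sub>C fst z, c *\<^sub>C snd z)"
definition "cinner_prod z w = cinner (fst z) (fst w) + cinner (snd z) (snd w)"

instance
proof
  fix x y z :: "'a \<times> 'b" and a b :: complex and r :: real
  show "a *\<^sub>C (x + y) = a *\<^sub>C x + a *\<^sub>C y" "(a + b) *\<^sub>C x = a *\<^sub>C x + b *\<^sub>C x"
    "a *\<^sub>C b *\<^sub>C x = (a * b) *\<^sub>C x" "complex_of_real r *\<^sub>C x = r *\<^sub>R x"
    by (simp_all add: scaleC_prod_def prod_eq_iff scaleC_add_right scaleC_add_left scaleC_scaleC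
        scaleC_of_real)
  show "cinner x y = cnj (cinner y x)"
    using cinner_commute[of "fst x" "fst y"] cinner_commute[of "snd x" "snd y"]
    by (simp add: cinner_prod_def)
  show "cinner (x + y) z = cinner x z + cinner y z" "cinner (a *\<^sub>C x) y = a * cinner x y"
    by (simp_all add: cinner_prod_def scaleC_prod_def cinner_add_left cinner_scaleC_left algebra_simps)
  show "Re (cinner x y) = inner x y"
    by (simp add: cinner_prod_def inner_prod_def Re_cinner)
qed

end

lemma isometric_embedding_pair:
  assumes "isometric_embedding V1 W1" "isometric_embedding V2 W2" and orth: "\<And>x. W2 (V1 x) = 0"
  shows "isometric_embedding (\<lambda>z. V1 (fst z) + V2 (snd z)) (\<lambda>y. (W1 y, W2 y))"
proof -
  interpret V1: isometric_embedding V1 W1 by (rule assms)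
  interpret V2: isometric_embedding V2 W2 by (rule assms)
  have orth': "W1 (V2 y) = 0" for y
  proof -
    have "inner (W1 (V2 y)) (W1 (V2 y)) = inner (V1 (W1 (V2 y))) (V2 y)"
      by (simp add: V1.adjoint)
    also have "\<dots> = 0"
      by (simp add: V2.adjoint' orth)
    finally show ?thesis by simp
  qed
  note lin = bounded_linear.linear[OF V1.bounded_linear_W] bounded_linear.linear[OF V2.bounded_linear_W]
  show ?thesis
  proof (rule isometric_embedding.intro)
    show "bounded_linear (\<lambda>z. V1 (fst z) + V2 (snd z))"
      by (intro bounded_linear_add bounded_linear_compose[OF V1.bounded_linear_V bounded_linear_fst]
          bounded_linear_compose[OF V2.bounded_linear_V bounded_linear_snd])
    show "bounded_linear (\<lambda>y. (W1 y, W2 y))"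
      by (intro bounded_linear_Pair V1.bounded_linear_W V2.bounded_linear_W)
  qed (auto simp: scaleC_prod_def V1.V_scaleC V2.V_scaleC V1.W_scaleC V2.W_scaleC scaleC_add_right
      V1.W_V V2.W_V orth orth' linear_add[OF lin(1)] linear_add[OF lin(2)] inner_prod_def
      inner_add_left V1.adjoint V2.adjoint)
qed

lift_definition ell2_single :: "nat \<Rightarrow> 'a::complex_hilbert_space \<Rightarrow> 'a ell2"
  is "\<lambda>n x k. if k = n then x else 0"
  by (rule summable_finite[of "{_}"]) auto

lemma isometric_embedding_ell2_single:
  "isometric_embedding (ell2_single n) (\<lambda>f. Rep_ell2 f n)"
proof -
  have adj: "inner (ell2_single n x) f = inner x (Rep_ell2 f n)" for x :: 'a and f
  proof (transfer)
    fix n and x :: 'a and f :: "nat \<Rightarrow> 'a"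
    have "(\<Sum>k. inner (if k = n then x else 0) (f k)) = (\<Sum>k\<in>{n}. inner (if k = n then x else 0) (f k))"
      by (rule suminf_finite) auto
    then show "(\<Sum>k. inner (if k = n then x else 0) (f k)) = inner x (f n)"
      by simp
  qed
  have norm: "norm (ell2_single n x) = norm x" for x :: 'a
    by (simp add: norm_eq_sqrt_inner adj) (simp add: ell2_single.rep_eq)
  show ?thesis
  proof (rule isometric_embedding.intro)
    show "bounded_linear (ell2_single n :: 'a \<Rightarrow> _)"
    proof (rule bounded_linear_intro[of _ 1])
      show "ell2_single n (x + y) = ell2_single n x + ell2_single n y"
        "ell2_single n (r *\<^sub>R x) = r *\<^sub>R ell2_single n x" for x y :: 'a and r
        by (transfer; simp add: fun_eq_iff)+
    qed (simp add: norm)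
    show "bounded_linear (\<lambda>f :: 'a ell2. Rep_ell2 f n)"
      by (rule bounded_linear_intro[of _ 1])
        (simp_all add: plus_ell2.rep_eq scaleR_ell2.rep_eq norm_Rep_ell2_le)
    show "ell2_single n (c *\<^sub>C x) = c *\<^sub>C ell2_single n x" for c and x :: 'a
      by transfer (simp add: fun_eq_iff scaleC_zero_right)
  qed (simp_all add: adj ell2_single.rep_eq scaleC_ell2.rep_eq)
qed

definition pair_to_ell2 :: "nat \<Rightarrow> nat \<Rightarrow> 'a \<times> 'a \<Rightarrow> 'a::complex_hilbert_space ell2" where
  "pair_to_ell2 i j z = ell2_single i (fst z) + ell2_single j (snd z)"

lemma isometric_embedding_pair_to_ell2:
  assumes "i \<noteq> j"
  shows "isometric_embedding (pair_to_ell2 i j) (\<lambda>f. (Rep_ell2 f i, Rep_ell2 f j))"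
  unfolding pair_to_ell2_def[abs_def]
  by (rule isometric_embedding_pair[OF isometric_embedding_ell2_single isometric_embedding_ell2_single])
    (use assms in \<open>simp add: ell2_single.rep_eq\<close>)

lemma isometric_embedding_quadruple_to_ell2:
  "isometric_embedding (\<lambda>z. pair_to_ell2 0 1 (fst z) + pair_to_ell2 2 3 (snd z))
    (\<lambda>f. ((Rep_ell2 f 0, Rep_ell2 f 1), (Rep_ell2 f 2, Rep_ell2 f 3)))"
  by (rule isometric_embedding_pair[OF isometric_embedding_pair_to_ell2 isometric_embedding_pair_to_ell2])
    (simp_all add: pair_to_ell2_def ell2_single.rep_eq plus_ell2.rep_eq zero_prod_def)

text \<open>For \<open>c\<^sup>2 + s\<^sup>2 = 1\<close> the diagonal \<open>x \<mapsto> (c x, s x)\<close> compresses \<open>A \<oplus> C\<close> to \<open>c\<^sup>2 A + s\<^sup>2 C\<close>.\<close>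

lemma isometric_embedding_diagonal:
  assumes "c\<^sup>2 + s\<^sup>2 = (1::real)"
  shows "isometric_embedding (\<lambda>x::'a::complex_hilbert_space. (c *\<^sub>R x, s *\<^sub>R x))
    (\<lambda>z. c *\<^sub>R fst z + s *\<^sub>R snd z)"
proof (rule isometric_embedding.intro)
  show "bounded_linear (\<lambda>x::'a. (c *\<^sub>R x, s *\<^sub>R x))"
    by (intro bounded_linear_Pair bounded_linear_scaleR_right)
  show "bounded_linear (\<lambda>z::'a \<times> 'a. c *\<^sub>R fst z + s *\<^sub>R snd z)"
    by (intro bounded_linear_add bounded_linear_const_scaleR bounded_linear_fst bounded_linear_snd)
  show "c *\<^sub>R fst (c *\<^sub>R x, s *\<^sub>R x) + s *\<^sub>R snd (c *\<^sub>R x, s *\<^sub>R x) = x" for x :: 'a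
    using assms by (simp add: scaleR_add_left[symmetric] power2_eq_square)
qed (auto simp: scaleC_prod_def scaleC_scaleR_commute scaleC_add_right inner_prod_def inner_add_right)

definition direct_sum :: "('a \<Rightarrow> 'a) \<Rightarrow> ('b \<Rightarrow> 'b) \<Rightarrow> 'a \<times> 'b \<Rightarrow> 'a \<times> 'b" where
  "direct_sum A C z = (A (fst z), C (snd z))"

lemma self_adjoint_direct_sum:
  assumes A: "self_adjoint A" and C: "self_adjoint C"
  shows "self_adjoint (direct_sum A C)"
proof -
  have "bounded_linear (\<lambda>z. (A (fst z), C (snd z)))"
    by (intro bounded_linear_Pair bounded_linear_compose[OF self_adjoint_bounded_linear[OF A] bounded_linear_fst]
        bounded_linear_compose[OF self_adjoint_bounded_linear[OF C] bounded_linear_snd])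
  then show ?thesis
    unfolding self_adjoint_iff_inner bounded_operator_def direct_sum_def[abs_def]
    by (auto simp: inner_prod_def scaleC_prod_def self_adjoint_inner[OF A] self_adjoint_inner[OF C]
        bounded_operator_scaleC[OF self_adjoint_bounded_operator[OF A]]
        bounded_operator_scaleC[OF self_adjoint_bounded_operator[OF C]])
qed

lemma poly_operator_direct_sum:
  "poly_operator id p (direct_sum A C) z = (poly_operator id p A (fst z), poly_operator id p C (snd z))"
proof -
  have "(direct_sum A C ^^ i) z = ((A ^^ i) (fst z), (C ^^ i) (snd z))" for i
    by (induction i) (simp_all add: direct_sum_def)
  then show ?thesis
    by (simp add: poly_operator_def prod_eq_iff fst_sum snd_sum)
qed

lemma real_spectrum_direct_sum:
  assumes A: "self_adjoint A" and C: "self_adjoint C"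
  shows "real_spectrum A \<union> real_spectrum C \<subseteq> real_spectrum (direct_sum A C)"
proof -
  have "bounded_below (\<lambda>x. A x - t *\<^sub>R x) \<and> bounded_below (\<lambda>y. C y - t *\<^sub>R y)"
    if bb: "bounded_below (\<lambda>z. direct_sum A C z - t *\<^sub>R z)" for t
  proof -
    obtain c where c: "c > 0" "\<And>z. c * norm z \<le> norm (direct_sum A C z - t *\<^sub>R z)"
      using bb by (auto simp: bounded_below_def)
    have A0: "A 0 = 0" "C 0 = 0"
      using linear_0 bounded_linear.linear self_adjoint_bounded_linear A C by metis+
    have "c * norm x \<le> norm (A x - t *\<^sub>R x)" for x
      using c(2)[of "(x, 0)"] by (simp add: direct_sum_def A0 norm_Pair)
    moreover have "c * norm y \<le> norm (C y - t *\<^sub>R y)" for y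
      using c(2)[of "(0, y)"] by (simp add: direct_sum_def A0 norm_Pair)
    ultimately show ?thesis
      using c(1) unfolding bounded_below_def by blast
  qed
  then have "t \<in> real_spectrum (direct_sum A C)" if "t \<in> real_spectrum A \<union> real_spectrum C" for t
    using that real_spectrum_iff[OF self_adjoint_direct_sum[OF assms]] real_spectrum_iff[OF A]
      real_spectrum_iff[OF C] by blast
  then show ?thesis
    by blast
qed

lemma functional_calculus_direct_sum:
  fixes A :: "'a::complex_hilbert_space \<Rightarrow> 'a" and C :: "'b::complex_hilbert_space \<Rightarrow> 'b"
  assumes nz: "\<exists>x::'a. x \<noteq> 0" "\<exists>y::'b. y \<noteq> 0" and A: "self_adjoint A" and C: "self_adjoint C"
    and g: "continuous_on (real_spectrum (direct_sum A C)) g"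
  shows "functional_calculus g (direct_sum A C) z =
    (functional_calculus g A (fst z), functional_calculus g C (snd z))"
proof -
  let ?S = "real_spectrum (direct_sum A C)"
  have nz': "\<exists>z::'a \<times> 'b. z \<noteq> 0"
    using nz by (auto simp: zero_prod_def)
  note AC = self_adjoint_direct_sum[OF A C]
  note sub = real_spectrum_direct_sum[OF A C]
  obtain p where p: "uniform_limit ?S (\<lambda>n. poly (p n)) g sequentially"
    using poly_uniform_limit_exists[OF compact_real_spectrum[OF nz' AC] g] by blast
  have "(\<lambda>n. poly_operator id (p n) (direct_sum A C) z) \<longlonglongrightarrow>
      (functional_calculus g A (fst z), functional_calculus g C (snd z))"
    unfolding poly_operator_direct_sum
  proof (rule tendsto_Pair)
    show "(\<lambda>n. poly_operator id (p n) A (fst z)) \<longlonglongrightarrow> functional_calculus g A (fst z)"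
      using sub by (intro functional_calculus_tendsto[OF nz(1) A continuous_on_subset[OF g]]
          uniform_limit_on_subset[OF p]) auto
    show "(\<lambda>n. poly_operator id (p n) C (snd z)) \<longlonglongrightarrow> functional_calculus g C (snd z)"
      using sub by (intro functional_calculus_tendsto[OF nz(2) C continuous_on_subset[OF g]]
          uniform_limit_on_subset[OF p]) auto
  qed
  moreover have "(\<lambda>n. poly_operator id (p n) (direct_sum A C) z) \<longlonglongrightarrow> functional_calculus g (direct_sum A C) z"
    by (rule functional_calculus_tendsto[OF nz' AC g p])
  ultimately show ?thesis
    by (rule LIMSEQ_unique[symmetric])
qed

section \<open>Consequences of strong operator convexity\<close>

definition form_below :: "real \<Rightarrow> ('a::complex_hilbert_space \<Rightarrow> 'a) \<Rightarrow> bool" where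
  "form_below b A \<longleftrightarrow> (\<exists>M<b. \<forall>x. inner (A x) x \<le> M * (norm x)\<^sup>2)"

lemma spectrum_lessThan_iff_form_below:
  fixes A :: "'a::complex_hilbert_space \<Rightarrow> 'a"
  assumes "\<exists>x::'a. x \<noteq> 0" "self_adjoint A"
  shows "spectrum A \<subseteq> complex_of_real ` {..<b} \<longleftrightarrow> form_below b A"
  unfolding form_below_def by (rule spectrum_lessThan_iff_form[OF assms])

lemma continuous_on_real_spectrum:
  fixes A :: "'a::complex_hilbert_space \<Rightarrow> 'a"
  assumes "\<exists>x::'a. x \<noteq> 0" "self_adjoint A" "form_below b A" "continuous_on {..<b} g"
  shows "continuous_on (real_spectrum A) g"
proof (rule continuous_on_subset[OF assms(4)])
  show "real_spectrum A \<subseteq> {..<b}"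
    using assms(1-3) spectrum_lessThan_iff_form_below[of A b] by auto
qed

lemma form_below_mono:
  assumes "form_below b A" "\<And>x. inner (C x) x \<le> inner (A x) x"
  shows "form_below b C"
  using assms unfolding form_below_def by (meson order_trans)

lemma form_below_direct_sum:
  assumes "form_below b A" "form_below b C"
  shows "form_below b (direct_sum A C)"
proof -
  obtain M N where M: "M < b" "\<And>x. inner (A x) x \<le> M * (norm x)\<^sup>2"
    and N: "N < b" "\<And>x. inner (C x) x \<le> N * (norm x)\<^sup>2"
    using assms by (auto simp: form_below_def)
  have "inner (direct_sum A C z) z \<le> max M N * (norm z)\<^sup>2" for z
  proof -
    have "inner (A (fst z)) (fst z) \<le> max M N * (norm (fst z))\<^sup>2"
      by (rule order_trans[OF M(2) mult_right_mono]) auto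
    moreover have "inner (C (snd z)) (snd z) \<le> max M N * (norm (snd z))\<^sup>2"
      by (rule order_trans[OF N(2) mult_right_mono]) auto
    ultimately show ?thesis
      by (simp add: direct_sum_def inner_prod_def norm_prod_def distrib_left)
  qed
  then show ?thesis
    unfolding form_below_def using M(1) N(1) by (intro exI[of _ "max M N"]) auto
qed

lemma SOC_continuous_on: "g \<in> SOC TYPE('u::complex_hilbert_space) J \<Longrightarrow> continuous_on J g"
  by (simp add: SOC_def)

text \<open>
  The defining inequality, expressed for any Hilbert space that embeds isometrically into the
  sequence space and for the projection onto the range of an isometry \<open>V\<close>.
\<close>

lemma SOC_compression:
  fixes A :: "'a::complex_hilbert_space \<Rightarrow> 'a" and V :: "'c::complex_hilbert_space \<Rightarrow> 'a"
    and U :: "'a \<Rightarrow> 'u::complex_hilbert_space ell2"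
  assumes g: "g \<in> SOC TYPE('u) {..<b}" and nz: "\<exists>x::'c. x \<noteq> 0"
    and "isometric_embedding U U'" and "isometric_embedding V V'"
    and A: "self_adjoint A" "form_below b A"
  shows "inner (functional_calculus g (\<lambda>x. V' (A (V x))) (V' y)) (V' y) \<le> inner (functional_calculus g A y) y"
proof -
  interpret U: isometric_embedding U U' by fact
  interpret V: isometric_embedding V V' by fact
  interpret UV: isometric_embedding "\<lambda>x. U (V x)" "\<lambda>y. V' (U' y)"
    by (rule isometric_embedding_compose) fact+
  define C where "C x = V' (A (V x))" for x
  define E where "E y = U (U' y)" for y
  define P where "P y = U (V (V' (U' y)))" for y
  define X where "X y = U (A (U' y))" for y
  have C: "self_adjoint C"
    unfolding C_def by (rule V.self_adjoint_compression[OF A(1)])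
  have "inner (C x) x = inner (A (V x)) (V x)" for x
    by (simp add: C_def V.adjoint')
  then have C_below: "form_below b C"
    using A(2) unfolding form_below_def by (metis V.norm_V)
  have nz': "\<exists>x::'a. x \<noteq> 0"
  proof -
    obtain x :: 'c where "x \<noteq> 0" using nz by blast
    then have "V x \<noteq> 0"
      using V.norm_V[of x] by auto
    then show ?thesis by blast
  qed
  note cont = SOC_continuous_on[OF g]
  have E: "orthogonal_projection E"
    unfolding E_def by (rule U.orthogonal_projection_range)
  have P: "orthogonal_projection P"
    unfolding P_def by (rule UV.orthogonal_projection_range)
  have EX: "operator_on E X"
    unfolding E_def X_def by (rule U.operator_on_copy[OF self_adjoint_bounded_operator[OF A(1)]])
  have EP: "operator_on E P"
    unfolding E_def P_def
    by (rule U.operator_on_copy[OF V.bounded_operator_range_projection])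
  have X: "self_adjoint X"
    unfolding X_def by (rule U.self_adjoint_copy[OF A(1)])
  have sp: "spectrum_on E X \<subseteq> complex_of_real ` {..<b}"
    unfolding E_def X_def U.spectrum_on_copy[OF self_adjoint_bounded_operator[OF A(1)]]
    using spectrum_lessThan_iff_form_below[OF nz' A(1)] A(2) by blast
  have "positive_operator (\<lambda>y. functional_calculus_on E g X y -
      (P \<circ> functional_calculus_on P g (P \<circ> X \<circ> P) \<circ> P) y)"
    using g E EX X sp EP P unfolding SOC_def operator_le_def by blast
  then have "0 \<le> inner (functional_calculus_on E g X (U y) -
      (P \<circ> functional_calculus_on P g (P \<circ> X \<circ> P) \<circ> P) (U y)) (U y)"
    by (rule positive_operator_inner)
  moreover have "functional_calculus_on E g X (U y) = U (functional_calculus g A y)"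
    unfolding E_def X_def
    by (simp add: U.functional_calculus_on_copy[OF nz' A(1) continuous_on_real_spectrum[OF nz' A cont]] U.W_V)
  moreover have "P \<circ> X \<circ> P = (\<lambda>y. U (V (C (V' (U' y)))))"
    by (simp add: fun_eq_iff P_def X_def C_def U.W_V)
  then have "functional_calculus_on P g (P \<circ> X \<circ> P) = (\<lambda>y. U (V (functional_calculus g C (V' (U' y)))))"
    unfolding P_def
    using UV.functional_calculus_on_copy[OF nz C continuous_on_real_spectrum[OF nz C C_below cont]] by simp
  then have "(P \<circ> functional_calculus_on P g (P \<circ> X \<circ> P) \<circ> P) (U y) = U (V (functional_calculus g C (V' y)))"
    by (simp add: P_def U.W_V V.W_V)
  ultimately show ?thesis
    by (simp add: inner_diff_left U.adjoint U.W_V V.adjoint C_def[abs_def])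
qed

text \<open>
  Compressing \<open>A \<oplus> C\<close> along the diagonal isometry \<open>x \<mapsto> (c x, s x)\<close> gives a convexity inequality with
  two independent test vectors.
\<close>

lemma SOC_convex_combination:
  fixes A C :: "'a::complex_hilbert_space \<Rightarrow> 'a" and U :: "'a \<times> 'a \<Rightarrow> 'u::complex_hilbert_space ell2"
  assumes g: "g \<in> SOC TYPE('u) {..<b}" and U: "isometric_embedding U U'" and nz: "\<exists>x::'a. x \<noteq> 0"
    and A: "self_adjoint A" "form_below b A" and C: "self_adjoint C" "form_below b C"
    and cs: "c\<^sup>2 + s\<^sup>2 = 1"
  shows "inner (functional_calculus g (\<lambda>x. c\<^sup>2 *\<^sub>R A x + s\<^sup>2 *\<^sub>R C x) (c *\<^sub>R x + s *\<^sub>R y)) (c *\<^sub>R x + s *\<^sub>R y)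
    \<le> inner (functional_calculus g A x) x + inner (functional_calculus g C y) y"
proof -
  note AC = self_adjoint_direct_sum[OF A(1) C(1)] form_below_direct_sum[OF A(2) C(2)]
  have nz': "\<exists>z::'a \<times> 'a. z \<noteq> 0"
    using nz by (auto simp: zero_prod_def)
  have lin: "linear A" "linear C"
    using bounded_linear.linear self_adjoint_bounded_linear A(1) C(1) by blast+
  have "c *\<^sub>R fst (direct_sum A C (c *\<^sub>R x, s *\<^sub>R x)) + s *\<^sub>R snd (direct_sum A C (c *\<^sub>R x, s *\<^sub>R x)) =
      c\<^sup>2 *\<^sub>R A x + s\<^sup>2 *\<^sub>R C x" for x
    by (simp add: direct_sum_def linear_scale[OF lin(1)] linear_scale[OF lin(2)] power2_eq_square)
  then show ?thesis
    using SOC_compression[OF g nz U isometric_embedding_diagonal[OF cs] AC, of "(x, y)"]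
    by (simp add: functional_calculus_direct_sum[OF nz nz A(1) C(1)
          continuous_on_real_spectrum[OF nz' AC SOC_continuous_on[OF g]]] inner_prod_def)
qed

text \<open>
  Strong operator convexity on a half-line unbounded to the left implies operator monotonicity. Given
  \<open>B \<le> A\<close> and \<open>0 < z < 1\<close>, the operator \<open>C = A - (A - B) / (1 - z)\<close> again has its spectrum below \<open>b\<close>,
  and \<open>z A + (1 - z) C = B\<close> exactly. With \<open>0\<close> as the second test vector the preceding inequality reads
  \<open>z g(B) \<le> g(A)\<close>, and \<open>z\<close> may tend to \<open>1\<close>.
\<close>

lemma SOC_operator_monotone:
  fixes A B :: "'a::complex_hilbert_space \<Rightarrow> 'a" and U :: "'a \<times> 'a \<Rightarrow> 'u::complex_hilbert_space ell2"
  assumes g: "g \<in> SOC TYPE('u) {..<b}" and U: "isometric_embedding U U'" and nz: "\<exists>x::'a. x \<noteq> 0"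
    and A: "self_adjoint A" "form_below b A" and B: "self_adjoint B"
    and le: "\<And>x. inner (B x) x \<le> inner (A x) x"
  shows "inner (functional_calculus g B x) x \<le> inner (functional_calculus g A x) x"
proof (rule field_le_mult_one_interval)
  fix z :: real assume z: "0 < z" "z < 1"
  define C where "C x = A x - (1 / (1 - z)) *\<^sub>R (A x - B x)" for x
  have C: "self_adjoint C"
    unfolding C_def[abs_def] by (intro self_adjoint_diff self_adjoint_scaleR A(1) B)
  have "inner (C x) x \<le> inner (A x) x" for x
    using le[of x] z by (simp add: C_def inner_diff_left)
  then have C_below: "form_below b C"
    by (rule form_below_mono[OF A(2)])
  have cs: "(sqrt z)\<^sup>2 + (sqrt (1 - z))\<^sup>2 = 1"
    using z by simp
  have comb: "(sqrt z)\<^sup>2 *\<^sub>R A x + (sqrt (1 - z))\<^sup>2 *\<^sub>R C x = B x" for x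
    using z by (simp add: C_def scaleR_diff_right scaleR_diff_left)
  have bA: "continuous_on (real_spectrum C) g" "continuous_on (real_spectrum B) g"
    using continuous_on_real_spectrum[OF nz C C_below SOC_continuous_on[OF g]]
      continuous_on_real_spectrum[OF nz B form_below_mono[OF A(2) le] SOC_continuous_on[OF g]] .
  have "functional_calculus g C 0 = 0"
    by (rule linear_0[OF bounded_linear.linear[OF self_adjoint_bounded_linear[OF
              self_adjoint_functional_calculus[OF nz C bA(1)]]]])
  moreover have "functional_calculus g B (sqrt z *\<^sub>R x) = sqrt z *\<^sub>R functional_calculus g B x"
    by (rule linear_scale[OF bounded_linear.linear[OF self_adjoint_bounded_linear[OF
              self_adjoint_functional_calculus[OF nz B bA(2)]]]])
  moreover have "sqrt z * sqrt z = z"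
    using z by simp
  ultimately show "z * inner (functional_calculus g B x) x \<le> inner (functional_calculus g A x) x"
    using SOC_convex_combination[OF g U nz A C C_below cs, of x 0] unfolding comb
    by (simp add: mult.assoc[symmetric])
qed

lemma self_adjoint_scalar: "self_adjoint (\<lambda>x. t *\<^sub>R x)"
  by (rule self_adjoint_scaleR[OF self_adjoint_id(2)])

lemma form_below_scalar: "t < b \<Longrightarrow> form_below b (\<lambda>x. t *\<^sub>R x)"
  by (auto simp: form_below_def power2_norm_eq_inner)

lemma functional_calculus_scalar:
  fixes x :: "'a::complex_hilbert_space"
  assumes "continuous_on {..<b} g" "t < b" "x \<noteq> 0"
  shows "functional_calculus g (\<lambda>x. t *\<^sub>R x) x = g t *\<^sub>R x"
  using assms
  by (intro functional_calculus_eigenvector continuous_on_real_spectrum[of _ b] self_adjoint_scalar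
      form_below_scalar) auto

lemma SOC_mono:
  assumes g: "g \<in> SOC TYPE('u::complex_hilbert_space) {..<b}" and nz: "\<exists>x::'u. x \<noteq> 0"
    and st: "s \<le> t" "t < b"
  shows "g s \<le> g t"
proof -
  obtain x :: 'u where x: "x \<noteq> 0" using nz by blast
  have "isometric_embedding (pair_to_ell2 0 1 :: 'u \<times> 'u \<Rightarrow> _) (\<lambda>f. (Rep_ell2 f 0, Rep_ell2 f 1))"
    by (rule isometric_embedding_pair_to_ell2) simp
  then have "inner (functional_calculus g (\<lambda>x. s *\<^sub>R x) x) x \<le> inner (functional_calculus g (\<lambda>x. t *\<^sub>R x) x) x"
    using st by (intro SOC_operator_monotone[OF g _ nz] self_adjoint_scalar form_below_scalar)
      (auto intro: mult_right_mono)
  moreover have "functional_calculus g (\<lambda>x. s *\<^sub>R x) x = g s *\<^sub>R x"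
    "functional_calculus g (\<lambda>x. t *\<^sub>R x) x = g t *\<^sub>R x"
    using st x by (auto intro!: functional_calculus_scalar[OF SOC_continuous_on[OF g]])
  ultimately show ?thesis
    using x by simp
qed

text \<open>
  For scalar operators \<open>p\<close> and \<open>q\<close>, the vector \<open>(c x, s x)\<close> in the range of the projection is the
  test vector for which the combination inequality becomes Jensen's inequality.
\<close>

lemma SOC_convex:
  assumes g: "g \<in> SOC TYPE('u::complex_hilbert_space) {..<b}" and nz: "\<exists>x::'u. x \<noteq> 0"
  shows "convex_on {..<b} g"
proof (rule convex_onI)
  fix t p q :: real
  assume t: "0 < t" "t < 1" and pq: "p \<in> {..<b}" "q \<in> {..<b}"
  obtain x :: 'u where x: "x \<noteq> 0" using nz by blast
  define c where "c = sqrt (1 - t)"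
  define s where "s = sqrt t"
  have cs: "c\<^sup>2 = 1 - t" "s\<^sup>2 = t" "c\<^sup>2 + s\<^sup>2 = 1"
    using t by (auto simp: c_def s_def)
  have U: "isometric_embedding (pair_to_ell2 0 1 :: 'u \<times> 'u \<Rightarrow> _) (\<lambda>f. (Rep_ell2 f 0, Rep_ell2 f 1))"
    by (rule isometric_embedding_pair_to_ell2) simp
  define m where "m = (1 - t) * p + t * q"
  have "m < b"
    using convexD_alt[of "{..<b}" p q t] t pq by (simp add: m_def)
  have fc: "functional_calculus g (\<lambda>x. r *\<^sub>R x) y = g r *\<^sub>R y" if "r < b" "y \<noteq> 0" for r and y :: 'u
    using that by (rule functional_calculus_scalar[OF SOC_continuous_on[OF g]])
  have nonzero: "c \<noteq> 0" "s \<noteq> 0"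
    using t by (auto simp: c_def s_def)
  have "(\<lambda>x::'u. c\<^sup>2 *\<^sub>R (p *\<^sub>R x) + s\<^sup>2 *\<^sub>R (q *\<^sub>R x)) = (\<lambda>x. m *\<^sub>R x)"
    by (simp add: cs m_def scaleR_add_left)
  moreover have "c *\<^sub>R (c *\<^sub>R x) + s *\<^sub>R (s *\<^sub>R x) = x"
    using cs(3) by (simp add: scaleR_add_left[symmetric] power2_eq_square)
  ultimately have "inner (functional_calculus g (\<lambda>x. m *\<^sub>R x) x) x
      \<le> inner (functional_calculus g (\<lambda>x. p *\<^sub>R x) (c *\<^sub>R x)) (c *\<^sub>R x)
        + inner (functional_calculus g (\<lambda>x. q *\<^sub>R x) (s *\<^sub>R x)) (s *\<^sub>R x)"
    using SOC_convex_combination[OF g U nz self_adjoint_scalar form_below_scalar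
        self_adjoint_scalar form_below_scalar cs(3), of p q "c *\<^sub>R x" "s *\<^sub>R x"] pq by simp
  also have "\<dots> = ((1 - t) * g p + t * g q) * inner x x"
  proof -
    have "inner (functional_calculus g (\<lambda>x. p *\<^sub>R x) (c *\<^sub>R x)) (c *\<^sub>R x) = c\<^sup>2 * g p * inner x x"
      using fc[of p "c *\<^sub>R x"] pq x nonzero by (simp add: power2_eq_square)
    moreover have "inner (functional_calculus g (\<lambda>x. q *\<^sub>R x) (s *\<^sub>R x)) (s *\<^sub>R x) = s\<^sup>2 * g q * inner x x"
      using fc[of q "s *\<^sub>R x"] pq x nonzero by (simp add: power2_eq_square)
    ultimately show ?thesis
      by (simp add: cs(1,2) distrib_right)
  qed
  finally have "g m * inner x x \<le> ((1 - t) * g p + t * g q) * inner x x"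
    using fc[OF \<open>m < b\<close> x] by simp
  then show "g ((1 - t) *\<^sub>R p + t *\<^sub>R q) \<le> (1 - t) * g p + t * g q"
    using x by (simp add: m_def)
qed simp

text \<open>
  Both inner points \<open>s\<close> and \<open>t - d\<close> are convex combinations of the outer points \<open>s - d\<close> and \<open>t\<close>, with
  exchanged weights; adding the two convexity inequalities gives the claim.
\<close>

lemma convex_on_increment_mono:
  fixes g :: "real \<Rightarrow> real"
  assumes g: "convex_on {..<b} g" and st: "s \<le> t" "t < b" and d: "d > 0"
  shows "g s - g (s - d) \<le> g t - g (t - d)"
proof -
  define l where "l = d / (t - s + d)"
  have "l * (t - s + d) = d"
    using st d by (simp add: l_def)
  then have "(1 - l) * (s - d) + l * t = s" "(1 - l) * t + l * (s - d) = t - d"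
    by (simp_all add: algebra_simps)
  moreover have "0 \<le> l" "l \<le> 1"
    using st d by (simp_all add: l_def)
  ultimately have l: "0 \<le> l" "l \<le> 1" "(1 - l) * (s - d) + l * t = s" "(1 - l) * t + l * (s - d) = t - d"
    by simp_all
  have "g ((1 - l) *\<^sub>R (s - d) + l *\<^sub>R t) \<le> (1 - l) * g (s - d) + l * g t"
    by (rule convex_onD[OF g]) (use l st d in auto)
  moreover have "g ((1 - l) *\<^sub>R t + l *\<^sub>R (s - d)) \<le> (1 - l) * g t + l * g (s - d)"
    by (rule convex_onD[OF g]) (use l st d in auto)
  ultimately have "g s + g (t - d) \<le> g (s - d) + g t"
    unfolding real_scaleR_def l(3,4) by (simp add: left_diff_distrib)
  then show ?thesis by simp
qed

text \<open>
  A convex increasing function that takes the same value \<open>k\<close> at \<open>u < v\<close> equals \<open>k\<close> on the whole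
  half-line up to \<open>v\<close>; if it is not constant, then \<open>g t > k\<close> for some \<open>t > v\<close>. Operator
  monotonicity excludes this. Take a two by two matrix \<open>T\<close> with eigenvalues \<open>v\<close> and \<open>q > t\<close>, whose
  eigenvector \<open>(\<alpha>, \<beta>)\<close> for \<open>q\<close> is slightly off the second axis, and \<open>B = diag (s, t)\<close> with \<open>s\<close> far to the
  left. Then \<open>B \<le> T\<close>, but \<open>g(T)\<close> equals \<open>k\<close> at the other eigenvector \<open>(\<beta>, -\<alpha>)\<close>, where \<open>g(B)\<close>
  is larger.
\<close>

lemma SOC_strict_mono:
  assumes g: "g \<in> SOC TYPE('u::complex_hilbert_space) {..<b}" and nz: "\<exists>x::'u. x \<noteq> 0"
    and nonconst: "\<not> (\<exists>c. \<forall>t<b. g t = c)" and uv: "u < v" "v < b"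
  shows "g u < g v"
proof (rule ccontr)
  assume "\<not> g u < g v"
  define k where "k = g v"
  have gu: "g u = k"
    using \<open>\<not> g u < g v\<close> SOC_mono[OF g nz, of u v] uv by (simp add: k_def)
  have flat: "g s = k" if s: "s \<le> v" for s
  proof (cases "s < u")
    case True
    define l where "l = (u - s) / (v - s)"
    have "l * (v - s) = u - s"
      using True uv by (simp add: l_def)
    then have "(1 - l) * s + l * v = u"
      by (simp add: algebra_simps)
    moreover have "0 < l" "l < 1"
      using True uv by (simp_all add: l_def)
    ultimately have l: "0 < l" "l < 1" "(1 - l) * s + l * v = u"
      by simp_all
    have "g ((1 - l) *\<^sub>R s + l *\<^sub>R v) \<le> (1 - l) * g s + l * g v"
      by (rule convex_onD[OF SOC_convex[OF g nz]]) (use l True uv in auto)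
    then have "(1 - l) * k \<le> (1 - l) * g s"
      unfolding real_scaleR_def l(3) gu k_def[symmetric] by (simp add: left_diff_distrib)
    then have "k \<le> g s"
      using l by simp
    moreover have "g s \<le> k"
      using SOC_mono[OF g nz, of s u] True uv gu by simp
    ultimately show ?thesis by simp
  next
    case False
    then show ?thesis
      using SOC_mono[OF g nz, of u s] SOC_mono[OF g nz, of s v] s uv gu by (simp add: k_def)
  qed
  obtain t where t: "t < b" "g t \<noteq> k"
    using nonconst by blast
  have "v < t"
    using flat t(2) by (meson not_le)
  have "k < g t"
    using SOC_mono[OF g nz, of v t] \<open>v < t\<close> t by (simp add: k_def)
  define q where "q = (t + b) / 2"
  define d where "d = q - v"
  \<comment> \<open>The angle is chosen such that \<open>d \<alpha>\<^sup>2 = e\<close>; then the lower right entry of \<open>T - B\<close> is \<open>e > 0\<close>.\<close>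
  define e where "e = (q - t) / 2"
  define \<alpha> where "\<alpha> = sqrt (e / d)"
  define \<beta> where "\<beta> = sqrt (1 - e / d)"
  have q: "t < q" "q < b"
    using t by (auto simp: q_def)
  have e: "0 < e" "e < d" "0 < d"
    using q \<open>v < t\<close> by (auto simp: e_def d_def)
  have \<alpha>: "\<alpha>\<^sup>2 = e / d" "\<alpha> > 0" and \<beta>: "\<beta>\<^sup>2 = 1 - e / d" and \<alpha>\<beta>: "\<alpha>\<^sup>2 + \<beta>\<^sup>2 = 1"
    using e by (auto simp: \<alpha>_def \<beta>_def field_simps)
  define c where "c = d * \<alpha> * \<beta>"
  \<comment> \<open>The off-diagonal entry of \<open>T - B\<close> is \<open>c\<close>, and the upper left one becomes \<open>c\<^sup>2 / e + e\<close>,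
    which makes the determinant nonnegative.\<close>
  define s where "s = v - c\<^sup>2 / e"
  have s: "s \<le> v"
    using e by (simp add: s_def)
  define B :: "'u \<times> 'u \<Rightarrow> 'u \<times> 'u" where "B = direct_sum (\<lambda>x. s *\<^sub>R x) (\<lambda>x. t *\<^sub>R x)"
  define w :: "'u \<times> 'u \<Rightarrow> 'u" where "w z = \<alpha> *\<^sub>R fst z + \<beta> *\<^sub>R snd z" for z
  define T :: "'u \<times> 'u \<Rightarrow> 'u \<times> 'u" where "T z = v *\<^sub>R z + d *\<^sub>R (\<alpha> *\<^sub>R w z, \<beta> *\<^sub>R w z)" for z
  have "self_adjoint (\<lambda>z. (\<alpha> *\<^sub>R w z, \<beta> *\<^sub>R w z))"
    using isometric_embedding.self_adjoint_copy[OF isometric_embedding_diagonal[OF \<alpha>\<beta>] self_adjoint_id(2)]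
    by (simp only: w_def)
  then have T: "self_adjoint T"
    unfolding T_def[abs_def] by (intro self_adjoint_add self_adjoint_scalar self_adjoint_scaleR)
  have T_form: "inner (T z) z = v * (norm z)\<^sup>2 + d * (norm (w z))\<^sup>2" for z
    by (simp add: T_def w_def inner_add_left inner_add_right inner_prod_def power2_norm_eq_inner algebra_simps)
  have "(norm (w z))\<^sup>2 \<le> (norm z)\<^sup>2" for z
  proof -
    have "norm (w z) \<le> norm z"
      unfolding w_def by (rule isometric_embedding.norm_W[OF isometric_embedding_diagonal[OF \<alpha>\<beta>]])
    then show ?thesis
      by (intro power_mono) auto
  qed
  then have "inner (T z) z \<le> q * (norm z)\<^sup>2" for z
    using e(3) mult_left_mono[of "(norm (w z))\<^sup>2" "(norm z)\<^sup>2" d]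
    by (simp add: T_form d_def algebra_simps)
  then have T_below: "form_below b T"
    unfolding form_below_def using q by blast
  have B: "self_adjoint B"
    unfolding B_def by (intro self_adjoint_direct_sum self_adjoint_scalar)
  have B_below: "form_below b B"
    unfolding B_def by (intro form_below_direct_sum form_below_scalar) (use s uv t in auto)
  have le: "inner (B z) z \<le> inner (T z) z" for z
  proof -
    obtain x y where z: "z = (x, y)" by (cases z)
    have coeffs: "d * \<alpha>\<^sup>2 = e" "d * \<beta>\<^sup>2 = t - v + e"
      using e by (auto simp: \<alpha> \<beta> right_diff_distrib) (simp add: e_def d_def field_simps)
    have "inner (T z) z - inner (B z) z =
        (v - s) * inner x x + (v - t) * inner y y + (d * \<alpha>\<^sup>2) * inner x x + 2 * c * inner x y
          + (d * \<beta>\<^sup>2) * inner y y"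
      by (simp add: z B_def direct_sum_def T_def w_def c_def inner_prod_def inner_add_left inner_add_right
          inner_commute power2_eq_square algebra_simps)
    also have "\<dots> = e * inner x x + (c\<^sup>2 / e * inner x x + 2 * c * inner x y + e * inner y y)"
      unfolding coeffs by (simp add: s_def algebra_simps)
    also have "c\<^sup>2 / e * inner x x + 2 * c * inner x y + e * inner y y =
        e * (norm ((c / e) *\<^sub>R x + y))\<^sup>2"
    proof -
      have eq: "e * (norm ((c / e) *\<^sub>R x + y))\<^sup>2 =
          e * ((c / e) * (c / e) * inner x x + 2 * (c / e) * inner x y + inner y y)"
        unfolding power2_norm_eq_inner inner_add_left inner_add_right inner_scaleR_left inner_scaleR_right
          inner_commute[of y x] by (simp add: algebra_simps)
      show ?thesis
        unfolding eq using e(1) by (simp add: power2_eq_square field_simps)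
    qed
    finally have "inner (T z) z - inner (B z) z = e * inner x x + e * (norm ((c / e) *\<^sub>R x + y))\<^sup>2" .
    moreover have "0 \<le> e * inner x x + e * (norm ((c / e) *\<^sub>R x + y))\<^sup>2"
      using e by simp
    ultimately show ?thesis by linarith
  qed
  obtain x :: 'u where x: "x \<noteq> 0" using nz by blast
  define z where "z = (\<beta> *\<^sub>R x, - \<alpha> *\<^sub>R x)"
  have nz2: "\<exists>z::'u \<times> 'u. z \<noteq> 0"
    using x by (auto simp: zero_prod_def)
  note cont = SOC_continuous_on[OF g]
  have "z \<noteq> 0"
    using x \<alpha>(2) by (simp add: z_def zero_prod_def)
  moreover have "T z = v *\<^sub>R z"
    by (simp add: T_def w_def z_def zero_prod_def[symmetric])
  ultimately have "functional_calculus g T z = k *\<^sub>R z"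
    using functional_calculus_eigenvector[OF T continuous_on_real_spectrum[OF nz2 T T_below cont]]
    by (simp add: k_def)
  moreover have "inner z z = inner x x"
    using \<alpha>\<beta> by (simp add: z_def inner_prod_def power2_eq_square distrib_right[symmetric] mult.assoc[symmetric])
  ultimately have gT: "inner (functional_calculus g T z) z = k * inner x x"
    by simp
  have scalar: "functional_calculus g (\<lambda>x. r *\<^sub>R x) y = g r *\<^sub>R y" if "r < b" for r and y :: 'u
  proof (cases "y = 0")
    case True
    have "continuous_on (real_spectrum (\<lambda>x::'u. r *\<^sub>R x)) g"
      by (rule continuous_on_real_spectrum[OF nz self_adjoint_scalar form_below_scalar[OF that] cont])
    then show ?thesis
      using linear_0[OF bounded_linear.linear[OF self_adjoint_bounded_linear[OF
            self_adjoint_functional_calculus[OF nz self_adjoint_scalar]]]] True by simp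
  qed (rule functional_calculus_scalar[OF cont that])
  have "functional_calculus g B z = (g s *\<^sub>R (\<beta> *\<^sub>R x), g t *\<^sub>R (- \<alpha> *\<^sub>R x))"
    using functional_calculus_direct_sum[OF nz nz self_adjoint_scalar self_adjoint_scalar
        continuous_on_real_spectrum[OF nz2 B B_below cont, unfolded B_def]] s uv t
    by (simp add: B_def[symmetric] z_def scalar)
  then have gB: "inner (functional_calculus g B z) z = (k * \<beta>\<^sup>2 + g t * \<alpha>\<^sup>2) * inner x x"
    by (simp add: z_def inner_prod_def flat[OF s] power2_eq_square algebra_simps)
  have "inner (functional_calculus g B z) z \<le> inner (functional_calculus g T z) z"
    by (rule SOC_operator_monotone[OF g isometric_embedding_quadruple_to_ell2 nz2 T T_below B le])
  then have "k * \<beta>\<^sup>2 + g t * \<alpha>\<^sup>2 \<le> k * (\<alpha>\<^sup>2 + \<beta>\<^sup>2)"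
    using x by (simp add: gB gT \<alpha>\<beta>)
  then have "g t * \<alpha>\<^sup>2 \<le> k * \<alpha>\<^sup>2"
    by (simp add: distrib_left)
  then show False
    using \<alpha>(2) \<open>k < g t\<close> by simp
qed

section \<open>The gap estimate\<close>

text \<open>
  If the positive operator \<open>D\<close> has infimum of the form \<open>m < \<delta>\<close>, then \<open>D - m\<close> is bounded below by
  \<open>\<delta> - m\<close>, because \<open>D\<close> is bounded below by \<open>\<delta>\<close>; but \<open>m\<close> is in the spectrum.
\<close>

lemma form_ge_inverse_onorm_inv:
  fixes D :: "'a::complex_hilbert_space \<Rightarrow> 'a"
  assumes nz: "\<exists>x::'a. x \<noteq> 0" and D: "self_adjoint D" and pos: "\<And>x. 0 \<le> inner (D x) x"
    and inv: "invertible_on id D"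
  defines "\<delta> \<equiv> inverse (onorm (inv D))"
  shows "0 < \<delta>" and "\<delta> * (norm x)\<^sup>2 \<le> inner (D x) x"
proof -
  obtain S where S: "bounded_operator S" "\<And>x. D (S x) = x" "\<And>x. S (D x) = x"
    using inv by (auto simp: invertible_on_id)
  have "inv D = S"
    using S by (intro inv_equality) auto
  note bS = bounded_operator_bounded_linear[OF S(1)]
  have "\<not> (\<forall>x. S x = 0)"
    using S nz by metis
  then have "onorm S > 0"
    by (simp add: onorm_pos_lt[OF bS])
  then show \<delta>: "0 < \<delta>"
    by (simp add: \<delta>_def \<open>inv D = S\<close>)
  have below: "\<delta> * norm x \<le> norm (D x)" for x
    using onorm[OF bS, of "D x"] \<open>onorm S > 0\<close> by (simp add: \<delta>_def \<open>inv D = S\<close> S(3) field_simps)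
  obtain m where m: "m \<in> real_spectrum D" "\<And>x. m * (norm x)\<^sup>2 \<le> inner (D x) x"
    using form_infimum_in_spectrum[OF nz D] by blast
  have "0 \<le> m"
    by (rule real_spectrum_ge[OF D _ m(1)]) (simp add: pos)
  have "\<delta> \<le> m"
  proof (rule ccontr)
    assume "\<not> \<delta> \<le> m"
    moreover have "(\<delta> - m) * norm x \<le> norm (D x - m *\<^sub>R x)" for x
      using below[of x] norm_triangle_ineq2[of "D x" "m *\<^sub>R x"] \<open>0 \<le> m\<close> by (simp add: left_diff_distrib)
    ultimately have "bounded_below (\<lambda>x. D x - m *\<^sub>R x)"
      unfolding bounded_below_def by (intro exI[of _ "\<delta> - m"]) auto
    then show False
      using m(1) real_spectrum_iff[OF D] by blast
  qed
  then show "\<delta> * (norm x)\<^sup>2 \<le> inner (D x) x"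
    using m(2)[of x] by (meson mult_right_mono order_trans zero_le_power2)
qed

theorem corollary3p9:
  fixes b :: real and g :: "real \<Rightarrow> real"
    and A B :: "'h::complex_hilbert_space \<Rightarrow> 'h"
  assumes "\<exists>x::'h. x \<noteq> 0"
    and "g \<in> SOC TYPE('h) {..<b}"
    and "\<exists>t<b. g t \<noteq> 0"
    and "\<not> (\<exists>c. \<forall>t<b. g t = c)"
    and "self_adjoint A" and "spectrum A \<subseteq> complex_of_real ` {..<b}"
    and "self_adjoint B" and "spectrum B \<subseteq> complex_of_real ` {..<b}"
    and "B <\<^sub>o\<^sub>p A"
  shows "let \<tau>\<^sub>A = min_spectrum A;
             \<tau>\<^sub>B = min_spectrum B;
             \<delta> = inverse (onorm (inv (\<lambda>x. A x - B x)))
         in (\<lambda>x. (g \<tau>\<^sub>A - g (\<tau>\<^sub>A - \<delta>)) *\<^sub>R x) \<le>\<^sub>o\<^sub>p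
              (\<lambda>x. functional_calculus g A x - functional_calculus g B x) \<and>
            g \<tau>\<^sub>A - g (\<tau>\<^sub>A - \<delta>) \<ge> g (\<tau>\<^sub>B + \<delta>) - g \<tau>\<^sub>B \<and>
            g (\<tau>\<^sub>B + \<delta>) - g \<tau>\<^sub>B > 0"
proof -
  note nz = assms(1) and g = assms(2) and A = assms(5) and B = assms(7)
  define \<tau>A where "\<tau>A = min_spectrum A"
  define \<tau>B where "\<tau>B = min_spectrum B"
  define \<delta> where "\<delta> = inverse (onorm (inv (\<lambda>x. A x - B x)))"
  let ?Ad = "\<lambda>x. A x - \<delta> *\<^sub>R x"
  have D: "positive_operator (\<lambda>x. A x - B x)" "invertible_on id (\<lambda>x. A x - B x)"
    using assms(9) by (simp_all add: operator_less_def)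
  note gap = form_ge_inverse_onorm_inv[OF nz self_adjoint_diff[OF A B]
      positive_operator_inner[OF D(1)] D(2), folded \<delta>_def]
  have below: "form_below b A" "form_below b B"
    using assms(6,8) spectrum_lessThan_iff_form_below[OF nz A] spectrum_lessThan_iff_form_below[OF nz B]
    by blast+
  have Ad: "self_adjoint ?Ad"
    by (rule self_adjoint_diff_scaleR[OF A])
  have Ad_below: "form_below b ?Ad"
    by (rule form_below_mono[OF below(1)]) (simp add: inner_diff_left gap(1) less_imp_le)
  note cont = continuous_on_real_spectrum[OF nz _ _ SOC_continuous_on[OF g]]
  note convex = SOC_convex[OF g nz]
  have "\<tau>A < b"
    using min_spectrum_in_spectrum[OF nz A] assms(6) by (auto simp: \<tau>A_def)
  have "(\<tau>B + \<delta>) * (norm x)\<^sup>2 \<le> inner (A x) x" for x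
    using min_spectrum_le_form[OF nz B, of x] gap(2)[of x]
    by (simp add: \<tau>B_def inner_diff_left distrib_right)
  then have "\<tau>B + \<delta> \<le> \<tau>A"
    using real_spectrum_ge[OF A] min_spectrum_in_spectrum[OF nz A] by (simp add: \<tau>A_def)
  have form: "(g \<tau>A - g (\<tau>A - \<delta>)) * (norm x)\<^sup>2 \<le>
      inner (functional_calculus g A x) x - inner (functional_calculus g B x) x" for x
  proof -
    have incr: "g \<tau>A - g (\<tau>A - \<delta>) \<le> g t - g (t - \<delta>)" if t: "t \<in> real_spectrum A" for t
    proof (rule convex_on_increment_mono[OF convex _ _ gap(1)])
      show "\<tau>A \<le> t"
        unfolding \<tau>A_def by (rule real_spectrum_ge[OF A min_spectrum_le_form[OF nz A] t])
      show "t < b"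
        using t assms(6) by auto
    qed
    have "continuous_on (real_spectrum A) (\<lambda>t. g (t - \<delta>))"
    proof (rule continuous_on_compose2[OF cont[OF Ad Ad_below]])
      show "continuous_on (real_spectrum A) (\<lambda>t. t - \<delta>)"
        by (intro continuous_intros)
      show "(\<lambda>t. t - \<delta>) ` real_spectrum A \<subseteq> real_spectrum ?Ad"
      proof (rule image_subsetI)
        show "t - \<delta> \<in> real_spectrum ?Ad" if "t \<in> real_spectrum A" for t
          using that real_spectrum_shift[OF A, of "t - \<delta>" \<delta>] by simp
      qed
    qed
    then have "(g \<tau>A - g (\<tau>A - \<delta>)) * (norm x)\<^sup>2 \<le>
        inner (functional_calculus g A x) x - inner (functional_calculus g ?Ad x) x"
      unfolding functional_calculus_shift[OF nz A cont[OF Ad Ad_below]]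
      by (intro functional_calculus_form_diff_ge[OF nz A cont[OF A below(1)] _ incr])
    moreover have "inner (functional_calculus g B x) x \<le> inner (functional_calculus g ?Ad x) x"
    proof (rule SOC_operator_monotone[OF g isometric_embedding_pair_to_ell2 nz Ad Ad_below B])
      show "(0::nat) \<noteq> 1" by simp
      show "inner (B x) x \<le> inner (A x - \<delta> *\<^sub>R x) x" for x
        using gap(2)[of x] by (simp add: inner_diff_left power2_norm_eq_inner)
    qed
    ultimately show ?thesis by linarith
  qed
  have "(\<lambda>x. (g \<tau>A - g (\<tau>A - \<delta>)) *\<^sub>R x) \<le>\<^sub>o\<^sub>p
      (\<lambda>x. functional_calculus g A x - functional_calculus g B x)"
    unfolding operator_le_def
  proof (rule positive_operatorI)
    show "self_adjoint (\<lambda>x. functional_calculus g A x - functional_calculus g B x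
        - (g \<tau>A - g (\<tau>A - \<delta>)) *\<^sub>R x)"
      by (intro self_adjoint_diff_scaleR self_adjoint_diff self_adjoint_functional_calculus nz A B
          cont below)
    show "0 \<le> inner (functional_calculus g A x - functional_calculus g B x
        - (g \<tau>A - g (\<tau>A - \<delta>)) *\<^sub>R x) x" for x
      using form[of x] by (simp add: inner_diff_left power2_norm_eq_inner)
  qed
  moreover have "g (\<tau>B + \<delta>) - g \<tau>B \<le> g \<tau>A - g (\<tau>A - \<delta>)"
    using convex_on_increment_mono[OF convex \<open>\<tau>B + \<delta> \<le> \<tau>A\<close> \<open>\<tau>A < b\<close> gap(1)] by simp
  moreover have "g \<tau>B < g (\<tau>B + \<delta>)"
    by (rule SOC_strict_mono[OF g nz assms(4)])
      (use gap(1) \<open>\<tau>B + \<delta> \<le> \<tau>A\<close> \<open>\<tau>A < b\<close> in auto)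
  ultimately show ?thesis
    by (simp add: Let_def \<tau>A_def \<tau>B_def \<delta>_def)
qed

end
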